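(* Consider the leader-follower problem described in the context, with $n\in\mathbb N$ followers. Assume: (1) For every $t\in\{1,\dots,T\}$, the matrices $Q_t+P_t+H_t$ and $\bar Q_t$ are positive semi-definite, and $R_t$ and $R^0_t$ are positive definite. (2) The initial states $x^1_1,\dots,x^n_1$ of the followers are i.i.d. with mean $\mu_x\in\mathbb R^{d_x}$ and finite covariance matrix $\Sigma_x$, and the local noises $w^i_t$ of the followers are i.i.d. with zero mean and finite covariance matrix $\Sigma_w$. (3) The matrices $A_t,A^0_t,B_t,B^0_t,D_t,D^0_t,E_t,F_t,Q_t,Q^0_t,R_t,R^0_t,\Sigma_x,\Sigma_w$ do not depend on the number of followers $n$. Let $\mathbf g^*_\varepsilon$ denote the proposed strategy $$u^0_t=\bar L^{1,1}_t x^0_t+\bar L^{1,2}_t z_t,\qquad u^i_t=\breve L_t x^i_t+\bar L^{2,1}_t x^0_t+(\bar L^{2,2}_t-\breve L_t)z_t,\quad i=1,\dots,n,$$ for $t\in\{1,\dots,T\}$, with $z_t$ and the gains as defined in the context. Then $\mathbf g^*_\varepsilon$ is an $\varepsilon(n)$-optimal solution, i.e. $J_T(\mathbf g^*_\varepsilon)\le J_T(\mathbf g)+\varepsilon(n)$ for every strategy $\mathbf g$, where $\varepsilon(n)\in[0,\infty)$ and $\lim_{n\to\infty}\varepsilon(n)=0$, such that $$|J_T(\mathbf g^*_\varepsilon)-J_T^*|\le\varepsilon(n)\in\mathcal O\big(\tfrac1n\big).$$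
   Context: **System.** There are one leader (index $0$) and $n\in\mathbb N$ followers (indices $1,\dots,n$). The horizon is $T\in\mathbb N$, states and noises lie in $\mathbb R^{d_x}$, and actions lie in $\mathbb R^{d_u}$. With $\bar x_t:=\frac1n\sum_{i=1}^n x^i_t$ (the mean-field), $$x^0_{t+1}=A^0_tx^0_t+B^0_tu^0_t+D^0_t\bar x_t+w^0_t,\qquad x^i_{t+1}=A_tx^i_t+B_tu^i_t+D_t\bar x_t+E_tx^0_t+w^i_t .$$ All random variables $x^0_1,x^1_1,\dots,x^n_1$ and $w^0_t,w^1_t,\dots,w^n_t$ ($1\le t\le T$) are defined on a common probability space and are mutually independent. **Strategies.** A strategy $\mathbf g$ is a collection of control laws $u^0_t=g^0_t(x^0_t)$ and $u^i_t=g^i_t(x^i_t,x^0_t)$, $1\le t\le T$, $1\le i\le n$. The proposed strategy also uses $z_t$ (defined below), which every agent computes recursively from past leader states; the paper regards this as admissible under this information structure. **Cost.** With symmetric matrices $Q^0_t,F_t,R^0_t,Q_t,P_t,R_t,H_t$, $$J_T(\mathbf g)=\mathbb E\Big[\sum_{t=1}^T (x^0_t)^\intercal Q^0_tx^0_t+(\bar x_t-x^0_t)^\intercal F_t(\bar x_t-x^0_t)+(u^0_t)^\intercal R^0_tu^0_t+\frac1n\sum_{i=1}^n\big((x^i_t)^\intercal Q_tx^i_t+(x^i_t-x^0_t)^\intercal P_t(x^i_t-x^0_t)+(u^i_t)^\intercal R_tu^i_t\big)+\frac1{2n^2}\sum_{i,j=1}^n(x^i_t-x^j_t)^\intercal H_t(x^i_t-x^j_t)\Big].$$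 **Matrices and gains.** $$\bar A_t=\begin{bmatrix}A^0_t & D^0_t \\ E_t & A_t+D_t\end{bmatrix},\ \bar B_t=\begin{bmatrix}B^0_t & 0 \\ 0 & B_t\end{bmatrix},\ \bar Q_t=\begin{bmatrix}Q^0_t+P_t+F_t & -P_t-F_t \\ -P_t-F_t & Q_t+P_t+F_t\end{bmatrix},\ \bar R_t=\begin{bmatrix}R^0_t & 0 \\ 0 & R_t\end{bmatrix}.$$ Riccati recursions for $t=T,\dots,1$, with $\breve M_{T+1}=0$ and $\bar M_{T+1}=0$: $$\breve M_t=-A_t^\intercal\breve M_{t+1}B_t(B_t^\intercal\breve M_{t+1}B_t+R_t)^{-1}B_t^\intercal\breve M_{t+1}A_t+A_t^\intercal\breve M_{t+1}A_t+Q_t+P_t+H_t,$$ $$\bar M_t=-\bar A_t^\intercal\bar M_{t+1}\bar B_t(\bar B_t^\intercal\bar M_{t+1}\bar B_t+\bar R_t)^{-1}\bar B_t^\intercal\bar M_{t+1}\bar A_t+\bar A_t^\intercal\bar M_{t+1}\bar A_t+\bar Q_t.$$ Gains: $$\breve L_t=-(B_t^\intercal\breve M_{t+1}B_t+R_t)^{-1}B_t^\intercal\breve M_{t+1}A_t,\qquad \bar L_t=\begin{bmatrix}\bar L^{1,1}_t & \bar L^{1,2}_t \\ \bar L^{2,1}_t & \bar L^{2,2}_t\end{bmatrix}=-(\bar B_t^\intercal\bar M_{t+1}\bar B_t+\bar R_t)^{-1}\bar B_t^\intercal\bar M_{t+1}\bar A_t.$$ **Process $z$.** $z_1=\mu_x$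 and $z_{t+1}=(A_t+B_t\bar L^{2,2}_t+D_t)z_t+(B_t\bar L^{2,1}_t+E_t)x^0_t$, where $x^0_t$ is the leader state under the proposed strategy. **Optimal performance $J_T^*$.** $J_T^*$ is the optimal performance when the mean-field is also available to all agents. It is taken as known from earlier work that $J_T^*$ is attained by the linear strategy $u^0_t=\bar L^{1,1}_tx^0_t+\bar L^{1,2}_t\bar x_t$, $u^i_t=\breve L_tx^i_t+\bar L^{2,1}_tx^0_t+(\bar L^{2,2}_t-\breve L_t)\bar x_t$. *)

theory Defs
  imports "HOL-Probability.Probability" "HOL-Library.Landau_Symbols"
begin

definition sym_matrix :: "real^'m^'m \<Rightarrow> bool" where
  "sym_matrix A \<longleftrightarrow> transpose A = A"

definition quad :: "real^'m^'m \<Rightarrow> real^'m \<Rightarrow> real" where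
  "quad A v = v \<bullet> (A *v v)"

definition pos_semidef :: "real^'m^'m \<Rightarrow> bool" where
  "pos_semidef A \<longleftrightarrow> sym_matrix A \<and> (\<forall>v. 0 \<le> quad A v)"

definition pos_def :: "real^'m^'m \<Rightarrow> bool" where
  "pos_def A \<longleftrightarrow> sym_matrix A \<and> (\<forall>v. v \<noteq> 0 \<longrightarrow> 0 < quad A v)"

definition block :: "real^'a^'c \<Rightarrow> real^'b^'c \<Rightarrow> real^'a^'d \<Rightarrow> real^'b^'d \<Rightarrow> real^('a + 'b)^('c + 'd)" where
  "block X11 X12 X21 X22 = (\<chi> i j. case i of
      Inl k \<Rightarrow> (case j of Inl l \<Rightarrow> X11 $ k $ l | Inr l \<Rightarrow> X12 $ k $ l)
    | Inr k \<Rightarrow> (case j of Inl l \<Rightarrow> X21 $ k $ l | Inr l \<Rightarrow> X22 $ k $ l))"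

definition block11 :: "real^('a::finite + 'b::finite)^('c::finite + 'd::finite) \<Rightarrow> real^'a^'c" where
  "block11 X = (\<chi> i j. X $ Inl i $ Inl j)"

definition block12 :: "real^('a::finite + 'b::finite)^('c::finite + 'd::finite) \<Rightarrow> real^'b^'c" where
  "block12 X = (\<chi> i j. X $ Inl i $ Inr j)"

definition block21 :: "real^('a::finite + 'b::finite)^('c::finite + 'd::finite) \<Rightarrow> real^'a^'d" where
  "block21 X = (\<chi> i j. X $ Inr i $ Inl j)"

definition block22 :: "real^('a::finite + 'b::finite)^('c::finite + 'd::finite) \<Rightarrow> real^'b^'d" where
  "block22 X = (\<chi> i j. X $ Inr i $ Inr j)"

text \<open>
  The deterministic data of the problem: the horizon and, for each time in
  \<open>{1..hor d}\<close>, the system and cost matrices. A suffix \<open>0\<close> marks the matrices of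
  the leader. States have dimension \<open>CARD('x)\<close>, actions \<open>CARD('u)\<close>. Nothing in this
  record depends on the number of followers.
\<close>

record ('x, 'u) lq_data =
  hor :: nat
  mA0 :: "nat \<Rightarrow> real^('x::finite)^'x"
  mB0 :: "nat \<Rightarrow> real^('u::finite)^'x"
  mD0 :: "nat \<Rightarrow> real^'x^'x"
  mA :: "nat \<Rightarrow> real^'x^'x"
  mB :: "nat \<Rightarrow> real^'u^'x"
  mD :: "nat \<Rightarrow> real^'x^'x"
  mE :: "nat \<Rightarrow> real^'x^'x"
  mQ0 :: "nat \<Rightarrow> real^'x^'x"
  mF :: "nat \<Rightarrow> real^'x^'x"
  mR0 :: "nat \<Rightarrow> real^'u^'u"
  mQ :: "nat \<Rightarrow> real^'x^'x"
  mP :: "nat \<Rightarrow> real^'x^'x"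
  mR :: "nat \<Rightarrow> real^'u^'u"
  mH :: "nat \<Rightarrow> real^'x^'x"

definition Abar :: "('x::finite, 'u::finite) lq_data \<Rightarrow> nat \<Rightarrow> real^('x + 'x)^('x + 'x)" where
  "Abar d t = block (mA0 d t) (mD0 d t) (mE d t) (mA d t + mD d t)"

definition Bbar :: "('x::finite, 'u::finite) lq_data \<Rightarrow> nat \<Rightarrow> real^('u + 'u)^('x + 'x)" where
  "Bbar d t = block (mB0 d t) 0 0 (mB d t)"

definition Qbar :: "('x::finite, 'u::finite) lq_data \<Rightarrow> nat \<Rightarrow> real^('x + 'x)^('x + 'x)" where
  "Qbar d t = block (mQ0 d t + mP d t + mF d t) (- mP d t - mF d t)
                    (- mP d t - mF d t) (mQ d t + mP d t + mF d t)"

definition Rbar :: "('x::finite, 'u::finite) lq_data \<Rightarrow> nat \<Rightarrow> real^('u + 'u)^('u + 'u)" where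
  "Rbar d t = block (mR0 d t) 0 0 (mR d t)"

definition riccati_step ::
  "real^'m^'m \<Rightarrow> real^'k^'m \<Rightarrow> real^'m^'m \<Rightarrow> real^'k^'k \<Rightarrow> real^'m^'m \<Rightarrow> real^'m^'m" where
  "riccati_step A B Q R M =
     - (transpose A ** M ** B ** matrix_inv (transpose B ** M ** B + R) ** transpose B ** M ** A)
     + transpose A ** M ** A + Q"

definition riccati_gain ::
  "real^'m^'m \<Rightarrow> real^'k^'m \<Rightarrow> real^'k^'k \<Rightarrow> real^'m^'m \<Rightarrow> real^'m^'k" where
  "riccati_gain A B R M =
     - (matrix_inv (transpose B ** M ** B + R) ** transpose B ** M ** A)"

text \<open>
  The backward recursion is run in reversed time: \<open>riccati_rev A B Q R T k\<close> is the
  matrix at time \<open>T + 1 - k\<close>, with the terminal value \<open>0\<close> at time \<open>T + 1\<close>.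
\<close>

primrec riccati_rev ::
  "(nat \<Rightarrow> real^'m^'m) \<Rightarrow> (nat \<Rightarrow> real^'k^'m) \<Rightarrow> (nat \<Rightarrow> real^'m^'m) \<Rightarrow> (nat \<Rightarrow> real^'k^'k) \<Rightarrow>
   nat \<Rightarrow> nat \<Rightarrow> real^'m^'m" where
  "riccati_rev A B Q R T 0 = 0"
| "riccati_rev A B Q R T (Suc k) =
     riccati_step (A (T - k)) (B (T - k)) (Q (T - k)) (R (T - k)) (riccati_rev A B Q R T k)"

definition Mbreve :: "('x::finite, 'u::finite) lq_data \<Rightarrow> nat \<Rightarrow> real^'x^'x" where
  "Mbreve d t = riccati_rev (mA d) (mB d) (\<lambda>s. mQ d s + mP d s + mH d s) (mR d)
                  (hor d) (hor d + 1 - t)"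

definition Mbar :: "('x::finite, 'u::finite) lq_data \<Rightarrow> nat \<Rightarrow> real^('x + 'x)^('x + 'x)" where
  "Mbar d t = riccati_rev (Abar d) (Bbar d) (Qbar d) (Rbar d) (hor d) (hor d + 1 - t)"

definition Lbreve :: "('x::finite, 'u::finite) lq_data \<Rightarrow> nat \<Rightarrow> real^'x^'u" where
  "Lbreve d t = riccati_gain (mA d t) (mB d t) (mR d t) (Mbreve d (t + 1))"

definition Lbar :: "('x::finite, 'u::finite) lq_data \<Rightarrow> nat \<Rightarrow> real^('x + 'x)^('u + 'u)" where
  "Lbar d t = riccati_gain (Abar d t) (Bbar d t) (Rbar d t) (Mbar d (t + 1))"

abbreviation "L11 d t \<equiv> block11 (Lbar d t)"
abbreviation "L12 d t \<equiv> block12 (Lbar d t)"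
abbreviation "L21 d t \<equiv> block21 (Lbar d t)"
abbreviation "L22 d t \<equiv> block22 (Lbar d t)"

definition mean_field :: "nat \<Rightarrow> (nat \<Rightarrow> real^'x) \<Rightarrow> real^'x" where
  "mean_field n x = (1 / real n) *\<^sub>R (\<Sum>i=1..n. x i)"

text \<open>
  Control laws are given all signals that occur in the various strategies; which of
  them are really used is what distinguishes the strategies below. The leader's law takes
  the time, the leader's state, the mean-field and \<open>z\<close>; a follower's law takes the
  follower's index, the time, its own state, the leader's state, the mean-field and \<open>z\<close>.
\<close>

type_synonym ('x, 'u) laws =
  "(nat \<Rightarrow> real^'x \<Rightarrow> real^'x \<Rightarrow> real^'x \<Rightarrow> real^'u) \<times>
   (nat \<Rightarrow> nat \<Rightarrow> real^'x \<Rightarrow> real^'x \<Rightarrow> real^'x \<Rightarrow> real^'x \<Rightarrow> real^'u)"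

text \<open>
  A sample path of the closed loop, as the triple of the leader's state, the followers' states
  and \<open>z\<close>; \<open>xi i\<close> is the initial state and \<open>w i t\<close> the noise of agent \<open>i\<close>, with agent \<open>0\<close>
  the leader. Time starts at 1; the value at time 0 is a dummy. By construction, \<open>z\<close> at
  time \<open>t\<close> is a function of the leader's states at times \<open>1, ..., t - 1\<close>.
\<close>

primrec path ::
  "('x::finite, 'u::finite) lq_data \<Rightarrow> nat \<Rightarrow> real^'x \<Rightarrow> ('x, 'u) laws \<Rightarrow>
   (nat \<Rightarrow> real^'x) \<Rightarrow> (nat \<Rightarrow> nat \<Rightarrow> real^'x) \<Rightarrow> nat \<Rightarrow>
   (real^'x) \<times> (nat \<Rightarrow> real^'x) \<times> (real^'x)" where
  "path d n mu g xi w 0 = (0, \<lambda>i. 0, 0)"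
| "path d n mu g xi w (Suc t) =
     (if t = 0 then (xi 0, xi, mu)
      else (case path d n mu g xi w t of (x0, x, z) \<Rightarrow>
        (let xb = mean_field n x in
         (mA0 d t *v x0 + mB0 d t *v fst g t x0 xb z + mD0 d t *v xb + w 0 t,
          \<lambda>i. mA d t *v x i + mB d t *v snd g i t (x i) x0 xb z + mD d t *v xb + mE d t *v x0 + w i t,
          (mA d t + mB d t ** L22 d t + mD d t) *v z + (mB d t ** L21 d t + mE d t) *v x0))))"

definition stage_cost ::
  "('x::finite, 'u::finite) lq_data \<Rightarrow> nat \<Rightarrow> nat \<Rightarrow>
   real^'x \<Rightarrow> (nat \<Rightarrow> real^'x) \<Rightarrow> real^'u \<Rightarrow> (nat \<Rightarrow> real^'u) \<Rightarrow> real" where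
  "stage_cost d n t x0 x u0 u =
     quad (mQ0 d t) x0 + quad (mF d t) (mean_field n x - x0) + quad (mR0 d t) u0
     + (1 / real n) * (\<Sum>i=1..n. quad (mQ d t) (x i) + quad (mP d t) (x i - x0) + quad (mR d t) (u i))
     + (1 / (2 * (real n)\<^sup>2)) * (\<Sum>i=1..n. \<Sum>j=1..n. quad (mH d t) (x i - x j))"

definition path_cost ::
  "('x::finite, 'u::finite) lq_data \<Rightarrow> nat \<Rightarrow> real^'x \<Rightarrow> ('x, 'u) laws \<Rightarrow>
   (nat \<Rightarrow> real^'x) \<Rightarrow> (nat \<Rightarrow> nat \<Rightarrow> real^'x) \<Rightarrow> real" where
  "path_cost d n mu g xi w =
     (\<Sum>t=1..hor d. case path d n mu g xi w t of (x0, x, z) \<Rightarrow>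
        (let xb = mean_field n x in
         stage_cost d n t x0 x (fst g t x0 xb z) (\<lambda>i. snd g i t (x i) x0 xb z)))"

text \<open>
  The initial states and noises of the model with a given number of followers; as above,
  agent \<open>0\<close> is the leader.
\<close>

record ('w, 'x) randomness =
  Om :: "'w measure"
  init :: "nat \<Rightarrow> 'w \<Rightarrow> real^('x::finite)"
  noise :: "nat \<Rightarrow> nat \<Rightarrow> 'w \<Rightarrow> real^'x"

text \<open>
  The expected cost, possibly infinite. When \<open>Q + P + H\<close>, \<open>Qbar\<close>, \<open>R\<close> and \<open>R0\<close> are positive
  semi-definite, the integrand is non-negative on every path, because with \<open>y = (x0, xb)\<close>
  the state part of the stage cost equals
  \<open>quad Qbar y + 1/n * (\<Sum>i. quad (Q + P + H) (x i - xb))\<close>.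
  Hence \<open>ennreal\<close> truncates nothing.
\<close>

definition J ::
  "('x::finite, 'u::finite) lq_data \<Rightarrow> nat \<Rightarrow> real^'x \<Rightarrow> ('w, 'x) randomness \<Rightarrow>
   ('x, 'u) laws \<Rightarrow> ennreal" where
  "J d n mu S g =
     (\<integral>\<^sup>+ \<omega>. ennreal (path_cost d n mu g (\<lambda>i. init S i \<omega>) (\<lambda>i t. noise S i t \<omega>)) \<partial>Om S)"

definition strategies :: "('x::finite, 'u::finite) laws set" where
  "strategies = {(\<lambda>t x0 xb z. g0 t x0, \<lambda>i t xi x0 xb z. g i t xi x0) | g0 g.
     (\<forall>t. g0 t \<in> borel_measurable borel) \<and>
     (\<forall>i t. (\<lambda>(xi, x0). g i t xi x0) \<in> borel_measurable borel)}"

definition mf_strategies :: "('x::finite, 'u::finite) laws set" where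
  "mf_strategies = {(\<lambda>t x0 xb z. g0 t x0 xb, \<lambda>i t xi x0 xb z. g i t xi x0 xb) | g0 g.
     (\<forall>t. (\<lambda>(x0, xb). g0 t x0 xb) \<in> borel_measurable borel) \<and>
     (\<forall>i t. (\<lambda>(xi, x0, xb). g i t xi x0 xb) \<in> borel_measurable borel)}"

definition J_star ::
  "('x::finite, 'u::finite) lq_data \<Rightarrow> nat \<Rightarrow> real^'x \<Rightarrow> ('w, 'x) randomness \<Rightarrow> ennreal" where
  "J_star d n mu S = (INF g \<in> mf_strategies. J d n mu S g)"

definition mf_linear :: "('x::finite, 'u::finite) lq_data \<Rightarrow> ('x, 'u) laws" where
  "mf_linear d =
     (\<lambda>t x0 xb z. L11 d t *v x0 + L12 d t *v xb,
      \<lambda>i t xi x0 xb z. Lbreve d t *v xi + L21 d t *v x0 + (L22 d t - Lbreve d t) *v xb)"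

definition proposed :: "('x::finite, 'u::finite) lq_data \<Rightarrow> ('x, 'u) laws" where
  "proposed d =
     (\<lambda>t x0 xb z. L11 d t *v x0 + L12 d t *v z,
      \<lambda>i t xi x0 xb z. Lbreve d t *v xi + L21 d t *v x0 + (L22 d t - Lbreve d t) *v z)"

definition mutually_independent :: "nat \<Rightarrow> nat \<Rightarrow> ('w, 'x::finite) randomness \<Rightarrow> bool" where
  "mutually_independent n T S \<longleftrightarrow>
     prob_space.indep_vars (Om S) (\<lambda>_. borel)
       (\<lambda>(i, t). if t = 0 then init S i else noise S i t) ({0..n} \<times> {0..T})"

definition identically_distributed :: "'w measure \<Rightarrow> ('i \<Rightarrow> 'w \<Rightarrow> real^'x) \<Rightarrow> 'i set \<Rightarrow> bool" where
  "identically_distributed M X I \<longleftrightarrow> (\<forall>i\<in>I. \<forall>j\<in>I. distr M borel (X i) = distr M borel (X j))"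

definition has_mean_cov :: "'w measure \<Rightarrow> ('w \<Rightarrow> real^'x) \<Rightarrow> real^'x \<Rightarrow> real^'x^'x \<Rightarrow> bool" where
  "has_mean_cov M X m C \<longleftrightarrow>
     integrable M X \<and> integral\<^sup>L M X = m \<and>
     (\<forall>a b. integrable M (\<lambda>\<omega>. (X \<omega> $ a - m $ a) * (X \<omega> $ b - m $ b)) \<and>
            (\<integral>\<omega>. (X \<omega> $ a - m $ a) * (X \<omega> $ b - m $ b) \<partial>M) = C $ a $ b)"

end

theory Submission
  imports Defs
begin

text \<open>
  Replacing the mean-field \<open>xb\<close> by \<open>z\<close> in the feedback does not change the deviations \<open>x i - xb\<close>,
  so the two costs share their deviation part. What remains is the cost of (leader's state, mean-field,
  error \<open>xb - z\<close>), which by linearity is the response to the leader's noise plus the response to the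
  centered average of the followers' noise; the latter has second moments of order \<open>1/n\<close>, and since
  its mean is zero, it changes the expected quadratic cost by \<open>O(1/n)\<close> only. The leader's noise need
  not have moments, and the costs may be infinite; therefore the estimate is made for a fixed
  realization of the leader's noise, uniformly, and integrated afterwards by Tonelli's theorem.
  Optimality of the Riccati gains enters only through the attainment of \<open>J_star\<close>.
\<close>

section \<open>Quadratic forms\<close>

text \<open>The choice of \<open>z\<close> matters for one reason: its recursion is that of the
  mean-field under mean-field feedback with the followers' noise removed, and it starts at the
  followers' mean. Without followers' noise \<open>z\<close> and \<open>xb\<close> coincide, so both
  closed loops run along one nominal trajectory, and \<open>nominal\<close> carries no flag for the
  feedback. The costs of the two fluctuations are therefore never compared with each other. Each
  expected mean part lies within a constant over \<open>n\<close> of the same nominal cost, and the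
  triangle inequality gives both directions at once. Terms linear in the fluctuation would be scaled
  by the nominal trajectory, for which no moment bound exists. They must vanish exactly rather than
  be estimated; independence of the leader's and the followers' inputs ensures this, since fixing
  the former leaves the fluctuation centered. As the costs live in \<open>ennreal\<close>, closeness
  is expressed by two additive inequalities instead of an absolute difference.\<close>

lemma quad_0 [simp]: "quad A 0 = 0"
  by (simp add: quad_def)

lemma pos_def_imp_quad_nonneg: "pos_def A \<Longrightarrow> 0 \<le> quad A v"
  by (cases "v = 0") (auto simp: pos_def_def less_imp_le)

lemma quad_add: "quad A (v + w) = quad A v + quad A w + (v \<bullet> (A *v w) + w \<bullet> (A *v v))"
  by (simp add: quad_def inner_add_left inner_add_right matrix_vector_right_distrib)

lemma quad_minus_swap: "quad A (v - w) = quad A (w - v)"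
  by (simp add: quad_def inner_diff_left inner_diff_right matrix_vector_mult_diff_distrib)

lemma quad_add_matrix: "quad (A + B) v = quad A v + quad B v"
  by (simp add: quad_def inner_add_right matrix_vector_mult_add_rdistrib)

lemma abs_quad_le: "\<bar>quad A v\<bar> \<le> onorm ((*v) A) * (norm v)\<^sup>2"
proof -
  have "\<bar>quad A v\<bar> \<le> norm v * norm (A *v v)"
    by (simp add: quad_def Cauchy_Schwarz_ineq2)
  also have "\<dots> \<le> norm v * (onorm ((*v) A) * norm v)"
    by (intro mult_left_mono onorm) auto
  finally show ?thesis
    by (simp add: power2_eq_square algebra_simps)
qed

lemma matrix_vector_mult_sum_right: "A *v sum f I = (\<Sum>i\<in>I. A *v f i)"
  for A :: "real^'a^'b"
  by (rule linear_sum) simp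

lemma inner_sum_UNIV_plus:
  fixes v w :: "real^('a::finite + 'b::finite)"
  shows "v \<bullet> w = (\<Sum>i\<in>UNIV. v $ Inl i * w $ Inl i) + (\<Sum>i\<in>UNIV. v $ Inr i * w $ Inr i)"
  by (simp add: inner_vec_def UNIV_Plus_UNIV[symmetric] sum.Plus del: UNIV_Plus_UNIV)

lemma quad_block:
  fixes A B C D :: "real^('a::finite)^'a"
  shows "quad (block A B C D) (\<chi> i. case i of Inl k \<Rightarrow> a $ k | Inr k \<Rightarrow> b $ k)
    = quad A a + a \<bullet> (B *v b) + b \<bullet> (C *v a) + quad D b"
proof -
  have *: "(\<Sum>j\<in>UNIV. f j) = (\<Sum>j\<in>UNIV. f (Inl j)) + (\<Sum>j\<in>UNIV. f (Inr j))"
    for f :: "'a + 'a \<Rightarrow> real"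
    by (simp add: UNIV_Plus_UNIV[symmetric] sum.Plus del: UNIV_Plus_UNIV)
  show ?thesis
    by (simp add: quad_def inner_sum_UNIV_plus matrix_vector_mult_def block_def *)
       (simp add: inner_vec_def distrib_left sum.distrib)
qed

lemma mean_field_add: "mean_field n (\<lambda>i. f i + g i) = mean_field n f + mean_field n g"
  by (simp add: mean_field_def sum.distrib scaleR_add_right)

lemma mean_field_const: "n \<ge> 1 \<Longrightarrow> mean_field n (\<lambda>i. c) = c"
  by (simp add: mean_field_def sum_constant_scaleR del: sum_constant)

lemma sum_diff_mean_field:
  assumes "n \<ge> 1"
  shows "(\<Sum>i=1..n. x i - mean_field n x) = 0"
  using assms by (simp add: sum_subtractf mean_field_def sum_constant_scaleR del: sum_constant)

text \<open>The cross terms are linear in \<open>e i\<close>, and the \<open>e i\<close> sum to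
  zero: the variance decomposition of a quadratic form around the mean.\<close>

lemma sum_quad_shift:
  assumes "(\<Sum>i=1..n. e i) = 0"
  shows "(\<Sum>i=1..n. quad A (m + e i)) = real n * quad A m + (\<Sum>i=1..n. quad A (e i))"
proof -
  have "(\<Sum>i=1..n. m \<bullet> (A *v e i) + e i \<bullet> (A *v m)) = 
      m \<bullet> (A *v (\<Sum>i=1..n. e i)) + (\<Sum>i=1..n. e i) \<bullet> (A *v m)"
    by (simp add: sum.distrib inner_sum_left inner_sum_right matrix_vector_mult_sum_right)
  also have "\<dots> = 0" using assms by simp
  finally show ?thesis
    by (simp add: quad_add sum.distrib)
qed

text \<open>Apply the shift identity around each \<open>- e i\<close>. The factor
  \<open>2 * real n\<close> turns the prefactor of the pairwise cost into \<open>1 / real n\<close>,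
  which is how \<open>mH\<close> joins \<open>mQ\<close> and \<open>mP\<close> in the weight of the
  deviations.\<close>

lemma sum_sum_quad_diff:
  assumes "(\<Sum>i=1..n. e i) = 0"
  shows "(\<Sum>i=1..n. \<Sum>j=1..n. quad A (e i - e j)) = 2 * real n * (\<Sum>i=1..n. quad A (e i))"
proof -
  have "(\<Sum>j=1..n. quad A (e i - e j)) = real n * quad A (e i) + (\<Sum>j=1..n. quad A (e j))" for i
  proof -
    have "(\<Sum>j=1..n. quad A (e i - e j)) = (\<Sum>j=1..n. quad A (- e i + e j))"
      by (simp add: quad_minus_swap)
    also have "\<dots> = real n * quad A (- e i) + (\<Sum>j=1..n. quad A (e j))"
      by (rule sum_quad_shift[OF assms])
    also have "quad A (- e i) = quad A (e i)"
      using quad_minus_swap[of A 0 "e i"] by simp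
    finally show ?thesis .
  qed
  then show ?thesis
    by (simp add: sum.distrib flip: sum_distrib_left del: One_nat_def)
qed

section \<open>Decomposition of the closed loop\<close>

text \<open>Both feedback laws are linear and differ only in the signal \<open>z\<close> or \<open>xb\<close> fed back.\<close>

definition signal_law :: "('x::finite, 'u::finite) lq_data \<Rightarrow> bool \<Rightarrow> ('x, 'u) laws" where
  "signal_law d p =
     (\<lambda>t x0 xb z. L11 d t *v x0 + L12 d t *v (if p then z else xb),
      \<lambda>i t xi x0 xb z. Lbreve d t *v xi + L21 d t *v x0 + (L22 d t - Lbreve d t) *v (if p then z else xb))"

lemma signal_law_apply:
  "fst (signal_law d p) t x0 xb z = L11 d t *v x0 + L12 d t *v (if p then z else xb)"
  "snd (signal_law d p) i t xi x0 xb z =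
     Lbreve d t *v xi + L21 d t *v x0 + (L22 d t - Lbreve d t) *v (if p then z else xb)"
  by (simp_all add: signal_law_def)

lemma proposed_eq_signal_law: "proposed d = signal_law d True"
  by (simp add: proposed_def signal_law_def)

lemma mf_linear_eq_signal_law: "mf_linear d = signal_law d False"
  by (simp add: mf_linear_def signal_law_def)

text \<open>The response of (leader's state, mean-field) to the leader's noise \<open>l\<close> alone. Here and below the
  index \<open>k\<close> stands for time \<open>k + 1\<close>, and the noise with index \<open>0\<close> is the initial state.\<close>

primrec nominal ::
  "('x::finite, 'u::finite) lq_data \<Rightarrow> real^'x \<Rightarrow> (nat \<Rightarrow> real^'x) \<Rightarrow> nat \<Rightarrow> (real^'x) \<times> (real^'x)" where
  "nominal d mu l 0 = (l 0, mu)"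
| "nominal d mu l (Suc k) = (case nominal d mu l k of (a, b) \<Rightarrow>
     (mA0 d (Suc k) *v a + mB0 d (Suc k) *v (L11 d (Suc k) *v a + L12 d (Suc k) *v b)
        + mD0 d (Suc k) *v b + l (Suc k),
      mA d (Suc k) *v b + mB d (Suc k) *v (L21 d (Suc k) *v a + L22 d (Suc k) *v b)
        + mD d (Suc k) *v b + mE d (Suc k) *v a))"

text \<open>The response to the averaged followers' noise \<open>nu\<close>; the third component is the error of the
  fed back signal, \<open>xb\<close> minus signal.\<close>

primrec fluct ::
  "('x::finite, 'u::finite) lq_data \<Rightarrow> bool \<Rightarrow> (nat \<Rightarrow> real^'x) \<Rightarrow> nat \<Rightarrow> (real^'x) \<times> (real^'x) \<times> (real^'x)" where
  "fluct d p nu 0 = (0, nu 0, if p then nu 0 else 0)"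
| "fluct d p nu (Suc k) = (case fluct d p nu k of (a, b, e) \<Rightarrow>
     (mA0 d (Suc k) *v a + mB0 d (Suc k) *v (L11 d (Suc k) *v a + L12 d (Suc k) *v (b - e))
        + mD0 d (Suc k) *v b,
      mA d (Suc k) *v b
        + mB d (Suc k) *v (L21 d (Suc k) *v a + L22 d (Suc k) *v (b - e) + Lbreve d (Suc k) *v e)
        + mD d (Suc k) *v b + mE d (Suc k) *v a + nu (Suc k),
      mA d (Suc k) *v e + mB d (Suc k) *v (Lbreve d (Suc k) *v e) + mD d (Suc k) *v e
        + (if p then nu (Suc k) else 0)))"

text \<open>Dynamics of a follower's state minus the mean-field. Everything common to all followers
  cancels: the coupling, the leader's state and the signal fed back. Hence there is no parameter
  \<open>p\<close>, and both feedback laws share this part.\<close>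

primrec deviation ::
  "('x::finite, 'u::finite) lq_data \<Rightarrow> (nat \<Rightarrow> real^'x) \<Rightarrow> nat \<Rightarrow> real^'x" where
  "deviation d eta 0 = eta 0"
| "deviation d eta (Suc k) = mA d (Suc k) *v deviation d eta k
     + mB d (Suc k) *v (Lbreve d (Suc k) *v deviation d eta k) + eta (Suc k)"

text \<open>The mean \<open>mu\<close> of the initial states is moved into the start of
  \<open>nominal\<close>, so that what is left has mean zero at index \<open>0\<close> too.\<close>

definition mean_noise :: "nat \<Rightarrow> real^'x \<Rightarrow> (nat \<Rightarrow> nat \<Rightarrow> real^'x) \<Rightarrow> nat \<Rightarrow> real^'x" where
  "mean_noise n mu v k = mean_field n (\<lambda>i. v i k) - (if k = 0 then mu else 0)"

definition dev_noise :: "nat \<Rightarrow> (nat \<Rightarrow> nat \<Rightarrow> real^'x) \<Rightarrow> nat \<Rightarrow> nat \<Rightarrow> real^'x" where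
  "dev_noise n v i k = v i k - mean_field n (\<lambda>i. v i k)"

lemma sum_deviation:
  assumes "n \<ge> 1"
  shows "(\<Sum>i=1..n. deviation d (dev_noise n v i) k) = 0"
proof (induction k)
  case 0
  show ?case
    using sum_diff_mean_field[OF assms, of "\<lambda>i. v i 0"] by (simp add: dev_noise_def)
next
  case (Suc k)
  have "(\<Sum>i=1..n. dev_noise n v i (Suc k)) = 0"
    using sum_diff_mean_field[OF assms, of "\<lambda>i. v i (Suc k)"] by (simp add: dev_noise_def)
  then show ?case
    using Suc by (simp add: sum.distrib flip: matrix_vector_mult_sum_right)
qed

text \<open>Superposition for a linear closed loop. With signal \<open>b - e\<close> the averaged
  action is \<open>L21 a + L22 (b - e) + Lbreve e\<close>, which explains the \<open>Lbreve\<close>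
  term in \<open>fluct\<close>. Subtracting the recursion of \<open>z\<close> from that of the
  mean-field leaves \<open>e\<close> driven by \<open>mA + mB Lbreve + mD\<close> and the averaged
  noise. The invariant speaks of the signal rather than of \<open>z\<close>, because under
  mean-field feedback \<open>z\<close> is computed but does not influence the states.\<close>

lemma path_signal_law:
  fixes d :: "('x::finite, 'u::finite) lq_data"
  assumes n: "n \<ge> 1"
    and nom: "nominal d mu (v 0) k = (a, b)"
    and flu: "fluct d p (mean_noise n mu v) k = (a', b', e)"
  obtains z where
    "path d n mu (signal_law d p) (\<lambda>i. v i 0) v (Suc k) =
       (a + a', \<lambda>i. b + b' + deviation d (dev_noise n v i) k, z)"
    "(if p then z else b + b') = b + b' - e"
proof -
  have "\<exists>z. path d n mu (signal_law d p) (\<lambda>i. v i 0) v (Suc k) =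
       (a + a', \<lambda>i. b + b' + deviation d (dev_noise n v i) k, z)
    \<and> (if p then z else b + b') = b + b' - e"
    using nom flu
  proof (induction k arbitrary: a b a' b' e)
    case 0
    then show ?case
      by (auto simp: fun_eq_iff mean_noise_def dev_noise_def)
  next
    case (Suc k)
    obtain a0 b0 where nom: "nominal d mu (v 0) k = (a0, b0)" by fastforce
    obtain a1 b1 e0 where flu: "fluct d p (mean_noise n mu v) k = (a1, b1, e0)"
      by (metis prod_cases3)
    define D where "D i = deviation d (dev_noise n v i) k" for i
    obtain z where z: "path d n mu (signal_law d p) (\<lambda>i. v i 0) v (Suc k) =
       (a0 + a1, \<lambda>i. b0 + b1 + D i, z)"
      and s: "(if p then z else b0 + b1) = b0 + b1 - e0"
      using Suc.IH[OF nom flu] unfolding D_def by blast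
    have D0: "mean_field n D = 0"
      by (simp add: mean_field_def D_def sum_deviation[OF n] del: One_nat_def)
    have mean: "mean_field n (\<lambda>i. b0 + b1 + D i) = b0 + b1"
      using D0 by (simp add: mean_field_add mean_field_const[OF n])
    have s': "(if p then z else mean_field n (\<lambda>i. b0 + b1 + D i)) = b0 + b1 - e0"
      unfolding mean by (rule s)
    have w: "v i (Suc k) = dev_noise n v i (Suc k) + mean_noise n mu v (Suc k)" for i
      by (simp add: dev_noise_def mean_noise_def)
    have step: "path d n mu (signal_law d p) (\<lambda>i. v i 0) v (Suc (Suc k)) =
       (mA0 d (Suc k) *v (a0 + a1)
          + mB0 d (Suc k) *v (L11 d (Suc k) *v (a0 + a1) + L12 d (Suc k) *v (b0 + b1 - e0))
          + mD0 d (Suc k) *v (b0 + b1) + v 0 (Suc k),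
        \<lambda>i. mA d (Suc k) *v (b0 + b1 + D i)
          + mB d (Suc k) *v (Lbreve d (Suc k) *v (b0 + b1 + D i) + L21 d (Suc k) *v (a0 + a1)
              + (L22 d (Suc k) - Lbreve d (Suc k)) *v (b0 + b1 - e0))
          + mD d (Suc k) *v (b0 + b1) + mE d (Suc k) *v (a0 + a1) + v i (Suc k),
        (mA d (Suc k) + mB d (Suc k) ** L22 d (Suc k) + mD d (Suc k)) *v z
          + (mB d (Suc k) ** L21 d (Suc k) + mE d (Suc k)) *v (a0 + a1))"
      by (subst path.simps(2)) (simp add: z mean Let_def signal_law_apply s' del: path.simps split del: if_split)
    note lin = matrix_vector_right_distrib matrix_vector_mult_diff_distrib
      matrix_vector_mult_add_rdistrib matrix_vector_mult_diff_rdistrib matrix_vector_mul_assoc[symmetric]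
    \<comment> \<open>The invariant read in each mode: the true mean-field has error zero, and a fed
      back \<open>z\<close> is determined by the error.\<close>
    have e0: "\<not> p \<Longrightarrow> e0 = 0" and zp: "p \<Longrightarrow> z = b0 + b1 - e0"
      using s by simp_all
    have leader: "fst (path d n mu (signal_law d p) (\<lambda>i. v i 0) v (Suc (Suc k))) = a + a'"
      unfolding step using Suc.prems nom flu
      by (auto simp: lin algebra_simps)
    have follower: "fst (snd (path d n mu (signal_law d p) (\<lambda>i. v i 0) v (Suc (Suc k)))) =
        (\<lambda>i. b + b' + deviation d (dev_noise n v i) (Suc k))"
      unfolding step using Suc.prems nom flu
      by (auto simp: lin w D_def algebra_simps)
    have signal: "(if p then snd (snd (path d n mu (signal_law d p) (\<lambda>i. v i 0) v (Suc (Suc k)))) else b + b')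
        = b + b' - e"
    proof (cases p)
      case True
      show ?thesis
        unfolding step using Suc.prems nom flu True
        by (auto simp: lin zp[OF True] algebra_simps)
    next
      case False
      show ?thesis
        using Suc.prems nom flu False e0 by auto
    qed
    show ?case
      using leader follower signal by (metis prod.collapse)
  qed
  then show ?thesis using that by blast
qed

section \<open>Splitting the cost into a mean part and a deviation part\<close>

definition mean_stage ::
  "('x::finite, 'u::finite) lq_data \<Rightarrow> nat \<Rightarrow> real^'x \<Rightarrow> real^'x \<Rightarrow> real^'u \<Rightarrow> real^'u \<Rightarrow> real" where
  "mean_stage d t a b u0 u =
     quad (mQ0 d t) a + quad (mF d t) (b - a) + quad (mR0 d t) u0
     + quad (mQ d t) b + quad (mP d t) (b - a) + quad (mR d t) u"

text \<open>The actions are written as nominal action plus fluctuation, so that every quadratic term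
  has a deterministic part (for fixed leader's noise) plus a part linear in \<open>fluct\<close>,
  the shape that \<open>mean_O1_quad\<close> expects.\<close>

definition mean_cost ::
  "('x::finite, 'u::finite) lq_data \<Rightarrow> (nat \<Rightarrow> (real^'x) \<times> (real^'x)) \<Rightarrow>
    (nat \<Rightarrow> (real^'x) \<times> (real^'x) \<times> (real^'x)) \<Rightarrow> real" where
  "mean_cost d c f = (\<Sum>k<hor d. case (c k, f k) of ((a, b), (a', b', e)) \<Rightarrow>
     mean_stage d (Suc k) (a + a') (b + b')
       ((L11 d (Suc k) *v a + L12 d (Suc k) *v b)
        + (L11 d (Suc k) *v a' + L12 d (Suc k) *v (b' - e)))
       ((L21 d (Suc k) *v a + L22 d (Suc k) *v b)
        + (L21 d (Suc k) *v a' + L22 d (Suc k) *v (b' - e) + Lbreve d (Suc k) *v e)))"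

definition dev_cost ::
  "('x::finite, 'u::finite) lq_data \<Rightarrow> nat \<Rightarrow> (nat \<Rightarrow> nat \<Rightarrow> real^'x) \<Rightarrow> real" where
  "dev_cost d n v = (\<Sum>k<hor d. (1 / real n) * (\<Sum>i=1..n.
     quad (mQ d (Suc k) + mP d (Suc k) + mH d (Suc k)) (deviation d (dev_noise n v i) k)
     + quad (mR d (Suc k)) (Lbreve d (Suc k) *v deviation d (dev_noise n v i) k)))"

text \<open>States and actions deviate from their means by vectors summing to zero, so all cross
  terms drop. The mean part is the cost of a population without deviations, where \<open>mH\<close>
  contributes nothing; the deviations meet \<open>mQ\<close> and \<open>mP\<close> through each
  follower and \<open>mH\<close> through the pairs.\<close>

lemma stage_cost_decomposition:
  assumes n: "n \<ge> 1" and e: "(\<Sum>i=1..n. e i) = 0" 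
  shows "stage_cost d n t a (\<lambda>i. b + e i) u0 (\<lambda>i. u + L *v e i) =
    mean_stage d t a b u0 u
    + (1 / real n) * (\<Sum>i=1..n. quad (mQ d t + mP d t + mH d t) (e i) + quad (mR d t) (L *v e i))"
proof -
  have mean: "mean_field n (\<lambda>i. b + e i) = b"
    using e by (simp add: mean_field_add mean_field_const[OF n]) (simp add: mean_field_def)
  have Le: "(\<Sum>i=1..n. L *v e i) = 0"
    using e by (simp flip: matrix_vector_mult_sum_right)
  have P: "(\<Sum>i=1..n. quad (mP d t) (b + e i - a)) =
      real n * quad (mP d t) (b - a) + (\<Sum>i=1..n. quad (mP d t) (e i))"
    using sum_quad_shift[OF e, of "mP d t" "b - a"] by (simp add: algebra_simps)
  show ?thesis
    using n sum_sum_quad_diff[OF e, of "mH d t"]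
    by (simp add: stage_cost_def mean mean_stage_def sum.distrib sum_quad_shift[OF e] sum_quad_shift[OF Le]
        P quad_add_matrix field_simps power2_eq_square del: One_nat_def)
qed

lemma path_cost_signal_law:
  assumes n: "n \<ge> 1"
  shows "path_cost d n mu (signal_law d p) (\<lambda>i. v i 0) v =
    mean_cost d (nominal d mu (v 0)) (fluct d p (mean_noise n mu v)) + dev_cost d n v"
proof -
  have "(case path d n mu (signal_law d p) (\<lambda>i. v i 0) v (Suc k) of (x0, x, z) \<Rightarrow>
        (let xb = mean_field n x in
         stage_cost d n (Suc k) x0 x (fst (signal_law d p) (Suc k) x0 xb z)
           (\<lambda>i. snd (signal_law d p) i (Suc k) (x i) x0 xb z)))
    = (case (nominal d mu (v 0) k, fluct d p (mean_noise n mu v) k) of ((a, b), (a', b', e)) \<Rightarrow>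
     mean_stage d (Suc k) (a + a') (b + b')
       ((L11 d (Suc k) *v a + L12 d (Suc k) *v b)
        + (L11 d (Suc k) *v a' + L12 d (Suc k) *v (b' - e)))
       ((L21 d (Suc k) *v a + L22 d (Suc k) *v b)
        + (L21 d (Suc k) *v a' + L22 d (Suc k) *v (b' - e) + Lbreve d (Suc k) *v e)))
     + (1 / real n) * (\<Sum>i=1..n.
     quad (mQ d (Suc k) + mP d (Suc k) + mH d (Suc k)) (deviation d (dev_noise n v i) k)
     + quad (mR d (Suc k)) (Lbreve d (Suc k) *v deviation d (dev_noise n v i) k))" for k
  proof -
    obtain a b where nom: "nominal d mu (v 0) k = (a, b)" by fastforce
    obtain a' b' e where flu: "fluct d p (mean_noise n mu v) k = (a', b', e)"
      by (metis prod_cases3)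
    define D where "D i = deviation d (dev_noise n v i) k" for i
    obtain z where z: "path d n mu (signal_law d p) (\<lambda>i. v i 0) v (Suc k) =
       (a + a', \<lambda>i. b + b' + D i, z)"
      and s: "(if p then z else b + b') = b + b' - e"
      using path_signal_law[OF n nom flu] unfolding D_def by blast
    have D0: "(\<Sum>i=1..n. D i) = 0"
      unfolding D_def by (rule sum_deviation[OF n])
    then have "mean_field n D = 0"
      by (simp add: mean_field_def)
    then have mean: "mean_field n (\<lambda>i. b + b' + D i) = b + b'"
      by (simp add: mean_field_add mean_field_const[OF n])
    have u0: "fst (signal_law d p) (Suc k) (a + a') (b + b') z =
      (L11 d (Suc k) *v a + L12 d (Suc k) *v b)
        + (L11 d (Suc k) *v a' + L12 d (Suc k) *v (b' - e))"
      unfolding signal_law_apply s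
      by (simp add: matrix_vector_right_distrib matrix_vector_mult_diff_distrib algebra_simps)
    \<comment> \<open>\<open>Lbreve\<close> acts on the own state minus the signal, that is on
      \<open>D i + e\<close>; hence one term \<open>Lbreve *v e\<close> in the averaged action and
      one term \<open>Lbreve *v D i\<close> in the deviation.\<close>
    have u: "(\<lambda>i. snd (signal_law d p) i (Suc k) (b + b' + D i) (a + a') (b + b') z) =
       (\<lambda>i. ((L21 d (Suc k) *v a + L22 d (Suc k) *v b)
        + (L21 d (Suc k) *v a' + L22 d (Suc k) *v (b' - e) + Lbreve d (Suc k) *v e))
        + Lbreve d (Suc k) *v D i)"
      unfolding signal_law_apply s
      by (simp add: matrix_vector_right_distrib matrix_vector_mult_diff_distrib
           matrix_vector_mult_diff_rdistrib fun_eq_iff algebra_simps)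
    show ?thesis
      by (simp add: z mean u0 u Let_def stage_cost_decomposition[OF n D0] nom flu
          D_def[symmetric] del: path.simps)
  qed
  then show ?thesis
    unfolding path_cost_def mean_cost_def dev_cost_def sum.distrib[symmetric]
    by (simp add: sum.atLeast1_atMost_eq del: path.simps)
qed

text \<open>The state part is the form of \<open>Qbar\<close> at the stacked vector
  \<open>(a, b)\<close>. Only this combination is known to be nonnegative, not \<open>mQ\<close>,
  \<open>mP\<close> and \<open>mF\<close> one by one. The sign allows the mean part to be separated
  from the deviation part inside \<open>ennreal\<close>.\<close>

lemma mean_stage_nonneg:
  fixes d :: "('x::finite, 'u::finite) lq_data"
  assumes "pos_semidef (Qbar d t)" "pos_def (mR d t)" "pos_def (mR0 d t)"
  shows "mean_stage d t a b u0 u \<ge> 0"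
proof -
  have minus: "(- X) *v y = - (X *v y)" for X :: "real^'x^'x" and y
    using matrix_vector_mult_diff_rdistrib[of 0 X y] by simp
  have "0 \<le> quad (Qbar d t) (\<chi> i. case i of Inl k \<Rightarrow> a $ k | Inr k \<Rightarrow> b $ k)"
    using assms(1) by (simp add: pos_semidef_def)
  also have "\<dots> = quad (mQ0 d t) a + quad (mF d t) (b - a) + quad (mQ d t) b + quad (mP d t) (b - a)"
    unfolding Qbar_def quad_block
    by (simp add: quad_def inner_diff_left inner_diff_right inner_add_right
        matrix_vector_mult_diff_rdistrib matrix_vector_mult_add_rdistrib minus
        matrix_vector_mult_diff_distrib algebra_simps)
  finally have "0 \<le> \<dots>" .
  moreover have "quad (mR d t) u \<ge> 0" "quad (mR0 d t) u0 \<ge> 0"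
    using assms by (auto intro: pos_def_imp_quad_nonneg)
  ultimately show ?thesis
    by (simp add: mean_stage_def)
qed

text \<open>Independence is available on a finite index set only, while \<open>path\<close> takes
  inputs for all indices. Agents beyond \<open>n\<close> also receive states, but no agent up to
  \<open>n\<close> sees them, so followers are compared on \<open>{1..n}\<close>.\<close>

lemma path_cong:
  assumes "\<And>i. i \<in> {0..n} \<Longrightarrow> xi i = xi' i"
    and "\<And>i k. i \<in> {0..n} \<Longrightarrow> k \<in> {1..<t} \<Longrightarrow> w i k = w' i k"
  shows "fst (path d n mu g xi w t) = fst (path d n mu g xi' w' t)
    \<and> snd (snd (path d n mu g xi w t)) = snd (snd (path d n mu g xi' w' t))
    \<and> (\<forall>i\<in>{1..n}. fst (snd (path d n mu g xi w t)) i = fst (snd (path d n mu g xi' w' t)) i)"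
  using assms
proof (induction t)
  case (Suc t)
  have IH: "fst (path d n mu g xi w t) = fst (path d n mu g xi' w' t)"
    "snd (snd (path d n mu g xi w t)) = snd (snd (path d n mu g xi' w' t))"
    "\<And>i. i \<in> {1..n} \<Longrightarrow> fst (snd (path d n mu g xi w t)) i = fst (snd (path d n mu g xi' w' t)) i"
    using Suc by auto
  then have "mean_field n (fst (snd (path d n mu g xi w t))) = mean_field n (fst (snd (path d n mu g xi' w' t)))"
    by (simp add: mean_field_def)
  then show ?case
    using IH Suc.prems
    by (auto simp: Let_def case_prod_beta)
qed simp

text \<open>The noise at time \<open>t\<close> acts on the state at \<open>t + 1\<close>, so the
  cost up to the horizon sees noise at times below \<open>hor d\<close>.\<close>

lemma path_cost_cong:
  assumes "\<And>i. i \<in> {0..n} \<Longrightarrow> xi i = xi' i"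
    and "\<And>i k. i \<in> {0..n} \<Longrightarrow> k \<in> {1..<hor d} \<Longrightarrow> w i k = w' i k"
  shows "path_cost d n mu g xi w = path_cost d n mu g xi' w'"
  unfolding path_cost_def
proof (rule sum.cong[OF refl])
  fix t assume t: "t \<in> {1..hor d}"
  have IH: "fst (path d n mu g xi w t) = fst (path d n mu g xi' w' t)"
    "snd (snd (path d n mu g xi w t)) = snd (snd (path d n mu g xi' w' t))"
    "\<And>i. i \<in> {1..n} \<Longrightarrow> fst (snd (path d n mu g xi w t)) i = fst (snd (path d n mu g xi' w' t)) i"
    using path_cong[of n xi xi' t w w' d mu g] assms t by auto
  then have "mean_field n (fst (snd (path d n mu g xi w t))) = mean_field n (fst (snd (path d n mu g xi' w' t)))"
    by (simp add: mean_field_def)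
  then show "(case path d n mu g xi w t of (x0, x, z) \<Rightarrow>
        (let xb = mean_field n x in
         stage_cost d n t x0 x (fst g t x0 xb z) (\<lambda>i. snd g i t (x i) x0 xb z))) = 
     (case path d n mu g xi' w' t of (x0, x, z) \<Rightarrow>
        (let xb = mean_field n x in
         stage_cost d n t x0 x (fst g t x0 xb z) (\<lambda>i. snd g i t (x i) x0 xb z)))"
    using IH by (simp add: case_prod_beta Let_def stage_cost_def)
qed

section \<open>Measurability\<close>

lemma borel_measurable_matrix_vector_mult [measurable]:
  fixes A :: "real^'a^'b"
  shows "(*v) A \<in> borel_measurable borel"
  by (intro borel_measurable_continuous_onI linear_continuous_on) auto

lemma borel_measurable_quad [measurable]:
  fixes A :: "real^'a^'a"
  shows "quad A \<in> borel_measurable borel"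
  unfolding quad_def by measurable

lemma borel_measurable_mean_field:
  fixes f :: "nat \<Rightarrow> 'a \<Rightarrow> real^'x"
  assumes "\<And>i. i \<in> {1..n} \<Longrightarrow> f i \<in> borel_measurable M"
  shows "(\<lambda>x. mean_field n (\<lambda>i. f i x)) \<in> borel_measurable M"
  unfolding mean_field_def using assms by (intro borel_measurable_scaleR borel_measurable_sum) auto

lemma borel_measurable_nominal:
  assumes "\<And>j. j \<le> k \<Longrightarrow> (\<lambda>x. l x j) \<in> borel_measurable M"
  shows "(\<lambda>x. fst (nominal d mu (l x) k)) \<in> borel_measurable M"
    and "(\<lambda>x. snd (nominal d mu (l x) k)) \<in> borel_measurable M"
proof -
  have "(\<lambda>x. fst (nominal d mu (l x) k)) \<in> borel_measurable M \<and>
    (\<lambda>x. snd (nominal d mu (l x) k)) \<in> borel_measurable M"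
    using assms
  proof (induction k)
    case (Suc k)
    then have [measurable]: "(\<lambda>x. fst (nominal d mu (l x) k)) \<in> borel_measurable M"
      "(\<lambda>x. snd (nominal d mu (l x) k)) \<in> borel_measurable M" "(\<lambda>x. l x (Suc k)) \<in> borel_measurable M"
      by auto
    show ?case
      by (simp add: case_prod_beta)
  qed simp
  then show "(\<lambda>x. fst (nominal d mu (l x) k)) \<in> borel_measurable M"
    and "(\<lambda>x. snd (nominal d mu (l x) k)) \<in> borel_measurable M" by auto
qed

lemma borel_measurable_fluct:
  assumes "\<And>j. j \<le> k \<Longrightarrow> (\<lambda>x. nu x j) \<in> borel_measurable M"
  shows "(\<lambda>x. fst (fluct d p (nu x) k)) \<in> borel_measurable M"
    and "(\<lambda>x. fst (snd (fluct d p (nu x) k))) \<in> borel_measurable M"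
    and "(\<lambda>x. snd (snd (fluct d p (nu x) k))) \<in> borel_measurable M"
proof -
  have "(\<lambda>x. fst (fluct d p (nu x) k)) \<in> borel_measurable M \<and>
    (\<lambda>x. fst (snd (fluct d p (nu x) k))) \<in> borel_measurable M \<and>
    (\<lambda>x. snd (snd (fluct d p (nu x) k))) \<in> borel_measurable M"
    using assms
  proof (induction k)
    case (Suc k)
    then have meas: "(\<lambda>x. fst (fluct d p (nu x) k)) \<in> borel_measurable M"
      "(\<lambda>x. fst (snd (fluct d p (nu x) k))) \<in> borel_measurable M"
      "(\<lambda>x. snd (snd (fluct d p (nu x) k))) \<in> borel_measurable M"
      "(\<lambda>x. nu x (Suc k)) \<in> borel_measurable M"
      by auto
    then have "(\<lambda>x. if p then nu x (Suc k) else 0) \<in> borel_measurable M"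
      by (cases p) auto
    with meas show ?case
      unfolding fluct.simps case_prod_beta fst_conv snd_conv
      by (intro conjI borel_measurable_add borel_measurable_diff
          measurable_compose[OF _ borel_measurable_matrix_vector_mult])
  qed (cases p; simp)
  then show "(\<lambda>x. fst (fluct d p (nu x) k)) \<in> borel_measurable M"
    and "(\<lambda>x. fst (snd (fluct d p (nu x) k))) \<in> borel_measurable M"
    and "(\<lambda>x. snd (snd (fluct d p (nu x) k))) \<in> borel_measurable M" by auto
qed

lemma borel_measurable_deviation:
  assumes "\<And>j. j \<le> k \<Longrightarrow> (\<lambda>x. eta x j) \<in> borel_measurable M"
  shows "(\<lambda>x. deviation d (eta x) k) \<in> borel_measurable M"
  using assms
proof (induction k)
  case (Suc k)
  then have [measurable]: "(\<lambda>x. deviation d (eta x) k) \<in> borel_measurable M"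
    "(\<lambda>x. eta x (Suc k)) \<in> borel_measurable M"
    by auto
  show ?case by simp
qed simp

lemma borel_measurable_mean_noise:
  assumes "\<And>i. i \<in> {1..n} \<Longrightarrow> (\<lambda>x. v x i k) \<in> borel_measurable M"
  shows "(\<lambda>x. mean_noise n mu (v x) k) \<in> borel_measurable M"
  unfolding mean_noise_def using assms
  by (intro borel_measurable_diff borel_measurable_mean_field) auto

lemma borel_measurable_dev_cost:
  assumes "\<And>i k. i \<in> {1..n} \<Longrightarrow> k < hor d \<Longrightarrow> (\<lambda>x. v x i k) \<in> borel_measurable M"
  shows "(\<lambda>x. dev_cost d n (v x)) \<in> borel_measurable M"
proof -
  have [measurable]: "(\<lambda>x. deviation d (dev_noise n (v x) i) k) \<in> borel_measurable M"
    if "i \<in> {1..n}" "k < hor d" for i k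
    using that assms unfolding dev_noise_def
    by (intro borel_measurable_deviation borel_measurable_diff borel_measurable_mean_field) auto
  show ?thesis
    unfolding dev_cost_def by measurable
qed

lemma borel_measurable_mean_cost:
  assumes "\<And>k. k < hor d \<Longrightarrow> (\<lambda>x. l x k) \<in> borel_measurable M"
    and "\<And>k. k < hor d \<Longrightarrow> (\<lambda>x. nu x k) \<in> borel_measurable M"
  shows "(\<lambda>x. mean_cost d (nominal d mu (l x)) (fluct d p (nu x))) \<in> borel_measurable M"
proof -
  have [measurable]: "(\<lambda>x. fst (nominal d mu (l x) k)) \<in> borel_measurable M"
    "(\<lambda>x. snd (nominal d mu (l x) k)) \<in> borel_measurable M"
    "(\<lambda>x. fst (fluct d p (nu x) k)) \<in> borel_measurable M"
    "(\<lambda>x. fst (snd (fluct d p (nu x) k))) \<in> borel_measurable M"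
    "(\<lambda>x. snd (snd (fluct d p (nu x) k))) \<in> borel_measurable M"
    if "k < hor d" for k
    using that assms by (auto intro!: borel_measurable_nominal borel_measurable_fluct)
  show ?thesis
    unfolding mean_cost_def mean_stage_def case_prod_beta fst_conv snd_conv by measurable
qed

section \<open>Centered random vectors of variance \<open>O(1/n)\<close>\<close>

text \<open>One constant serves all \<open>n\<close>. The class is closed under fixed matrices and
  under sums of arbitrarily correlated members, as needed for the components of
  \<open>fluct\<close>, which share the same noise.\<close>

definition centered_O1 :: "(nat \<Rightarrow> 'w measure) \<Rightarrow> (nat \<Rightarrow> 'w \<Rightarrow> real^'x) \<Rightarrow> bool" where
  "centered_O1 M V \<longleftrightarrow> (\<exists>K\<ge>0. \<forall>n\<ge>1. integrable (M n) (V n) \<and> integral\<^sup>L (M n) (V n) = 0 \<and>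
     integrable (M n) (\<lambda>\<omega>. (norm (V n \<omega>))\<^sup>2) \<and> (\<integral>\<omega>. (norm (V n \<omega>))\<^sup>2 \<partial>M n) \<le> K / real n)"

lemma centered_O1_zero: "centered_O1 M (\<lambda>n \<omega>. 0)"
  unfolding centered_O1_def by (intro exI[of _ 0]) auto

lemma centered_O1_matrix:
  fixes A :: "real^'a^'b"
  assumes "centered_O1 M V"
  shows "centered_O1 M (\<lambda>n \<omega>. A *v V n \<omega>)"
proof -
  obtain K where K: "K \<ge> 0" and V: "\<And>n. n \<ge> 1 \<Longrightarrow> integrable (M n) (V n)"
     "\<And>n. n \<ge> 1 \<Longrightarrow> integral\<^sup>L (M n) (V n) = 0"
     "\<And>n. n \<ge> 1 \<Longrightarrow> integrable (M n) (\<lambda>\<omega>. (norm (V n \<omega>))\<^sup>2)"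
     "\<And>n. n \<ge> 1 \<Longrightarrow> (\<integral>\<omega>. (norm (V n \<omega>))\<^sup>2 \<partial>M n) \<le> K / real n"
    using assms unfolding centered_O1_def by blast
  define c where "c = (onorm ((*v) A))\<^sup>2"
  have le: "(norm (A *v x))\<^sup>2 \<le> c * (norm x)\<^sup>2" for x
    using power_mono[OF onorm[of "(*v) A" x], of 2] by (simp add: c_def power_mult_distrib)
  have "integrable (M n) (\<lambda>\<omega>. A *v V n \<omega>) \<and> (\<integral>\<omega>. A *v V n \<omega> \<partial>M n) = 0 \<and>
     integrable (M n) (\<lambda>\<omega>. (norm (A *v V n \<omega>))\<^sup>2) \<and>
     (\<integral>\<omega>. (norm (A *v V n \<omega>))\<^sup>2 \<partial>M n) \<le> (c * K) / real n" if n: "n \<ge> 1" for n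
  proof (intro conjI)
    have [measurable]: "V n \<in> borel_measurable (M n)" using V(1)[OF n] by auto
    show "integrable (M n) (\<lambda>\<omega>. A *v V n \<omega>)"
      by (rule integrable_bounded_linear[OF _ V(1)[OF n]]) auto
    show "(\<integral>\<omega>. A *v V n \<omega> \<partial>M n) = 0"
      using integral_bounded_linear[OF _ V(1)[OF n], of "(*v) A"] V(2)[OF n] by simp
    show int: "integrable (M n) (\<lambda>\<omega>. (norm (A *v V n \<omega>))\<^sup>2)"
      by (rule Bochner_Integration.integrable_bound[of _ "\<lambda>\<omega>. c * (norm (V n \<omega>))\<^sup>2"])
         (use V(3)[OF n] le in \<open>auto simp: c_def\<close>)
    have "(\<integral>\<omega>. (norm (A *v V n \<omega>))\<^sup>2 \<partial>M n) \<le> (\<integral>\<omega>. c * (norm (V n \<omega>))\<^sup>2 \<partial>M n)"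
      by (rule integral_mono[OF int]) (use V(3)[OF n] le in auto)
    also have "\<dots> \<le> c * (K / real n)"
      by (rule mult_left_mono[OF V(4)[OF n], of c, folded integral_mult_right_zero]) (simp add: c_def)
    finally show "(\<integral>\<omega>. (norm (A *v V n \<omega>))\<^sup>2 \<partial>M n) \<le> (c * K) / real n" by simp
  qed
  then show ?thesis
    unfolding centered_O1_def using K by (intro exI[of _ "c * K"]) (auto simp: c_def)
qed

lemma centered_O1_add:
  assumes "centered_O1 M V" "centered_O1 M W"
  shows "centered_O1 M (\<lambda>n \<omega>. V n \<omega> + W n \<omega>)"
proof -
  obtain K where K: "K \<ge> 0" and V: "\<And>n. n \<ge> 1 \<Longrightarrow> integrable (M n) (V n)"
     "\<And>n. n \<ge> 1 \<Longrightarrow> integral\<^sup>L (M n) (V n) = 0"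
     "\<And>n. n \<ge> 1 \<Longrightarrow> integrable (M n) (\<lambda>\<omega>. (norm (V n \<omega>))\<^sup>2)"
     "\<And>n. n \<ge> 1 \<Longrightarrow> (\<integral>\<omega>. (norm (V n \<omega>))\<^sup>2 \<partial>M n) \<le> K / real n"
    using assms(1) unfolding centered_O1_def by blast
  obtain L where L: "L \<ge> 0" and W: "\<And>n. n \<ge> 1 \<Longrightarrow> integrable (M n) (W n)"
     "\<And>n. n \<ge> 1 \<Longrightarrow> integral\<^sup>L (M n) (W n) = 0"
     "\<And>n. n \<ge> 1 \<Longrightarrow> integrable (M n) (\<lambda>\<omega>. (norm (W n \<omega>))\<^sup>2)"
     "\<And>n. n \<ge> 1 \<Longrightarrow> (\<integral>\<omega>. (norm (W n \<omega>))\<^sup>2 \<partial>M n) \<le> L / real n"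
    using assms(2) unfolding centered_O1_def by blast
  \<comment> \<open>The factor 2 pays for the correlation of the summands.\<close>
  have le: "(norm (x + y))\<^sup>2 \<le> 2 * (norm x)\<^sup>2 + 2 * (norm y)\<^sup>2" for x y :: "real^('c::finite)"
  proof -
    have "(norm (x + y))\<^sup>2 \<le> (norm x + norm y)\<^sup>2"
      by (intro power_mono norm_triangle_ineq) auto
    also have "\<dots> \<le> 2 * (norm x)\<^sup>2 + 2 * (norm y)\<^sup>2"
      using sum_squares_bound[of "norm x" "norm y"] by (simp add: power2_sum)
    finally show ?thesis .
  qed
  have "integrable (M n) (\<lambda>\<omega>. V n \<omega> + W n \<omega>) \<and> (\<integral>\<omega>. V n \<omega> + W n \<omega> \<partial>M n) = 0 \<and>
     integrable (M n) (\<lambda>\<omega>. (norm (V n \<omega> + W n \<omega>))\<^sup>2) \<and>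
     (\<integral>\<omega>. (norm (V n \<omega> + W n \<omega>))\<^sup>2 \<partial>M n) \<le> (2 * K + 2 * L) / real n" if n: "n \<ge> 1" for n
  proof (intro conjI)
    have [measurable]: "V n \<in> borel_measurable (M n)" "W n \<in> borel_measurable (M n)"
      using V(1)[OF n] W(1)[OF n] by auto
    show "integrable (M n) (\<lambda>\<omega>. V n \<omega> + W n \<omega>)"
      using V(1)[OF n] W(1)[OF n] by auto
    show "(\<integral>\<omega>. V n \<omega> + W n \<omega> \<partial>M n) = 0"
      using V[OF n] W[OF n] by simp
    have int': "integrable (M n) (\<lambda>\<omega>. 2 * (norm (V n \<omega>))\<^sup>2 + 2 * (norm (W n \<omega>))\<^sup>2)"
      using V(3)[OF n] W(3)[OF n] by auto
    show int: "integrable (M n) (\<lambda>\<omega>. (norm (V n \<omega> + W n \<omega>))\<^sup>2)"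
      by (rule Bochner_Integration.integrable_bound[OF int']) (use le in auto)
    have "(\<integral>\<omega>. (norm (V n \<omega> + W n \<omega>))\<^sup>2 \<partial>M n) \<le> (\<integral>\<omega>. 2 * (norm (V n \<omega>))\<^sup>2 + 2 * (norm (W n \<omega>))\<^sup>2 \<partial>M n)"
      by (rule integral_mono[OF int int']) (rule le)
    also have "\<dots> \<le> 2 * (K / real n) + 2 * (L / real n)"
      using V(3,4)[OF n] W(3,4)[OF n] by simp
    finally show "(\<integral>\<omega>. (norm (V n \<omega> + W n \<omega>))\<^sup>2 \<partial>M n) \<le> (2 * K + 2 * L) / real n"
      by (simp add: add_divide_distrib)
  qed
  then show ?thesis
    unfolding centered_O1_def using K L by (intro exI[of _ "2 * K + 2 * L"]) auto
qed

lemma centered_O1_diff: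
  fixes V W :: "nat \<Rightarrow> 'w \<Rightarrow> real^'x"
  assumes "centered_O1 M V" "centered_O1 M W"
  shows "centered_O1 M (\<lambda>n \<omega>. V n \<omega> - W n \<omega>)"
proof -
  have "(- mat 1) *v x = - x" for x :: "real^'x"
    using matrix_vector_mult_diff_rdistrib[of 0 "mat 1" x] by simp
  then show ?thesis
    using centered_O1_add[OF assms(1) centered_O1_matrix[OF assms(2), of "- mat 1"]] by simp
qed

lemmas centered_O1_intros =
  centered_O1_zero centered_O1_matrix centered_O1_add centered_O1_diff

text \<open>The recursion is linear and its matrices do not depend on \<open>n\<close>; the constant
  may grow with \<open>k\<close>, but not with \<open>n\<close>.\<close>

lemma centered_O1_fluct:
  assumes "\<And>j. j \<le> k \<Longrightarrow> centered_O1 M (\<lambda>n \<omega>. nu n \<omega> j)"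
  shows "centered_O1 M (\<lambda>n \<omega>. fst (fluct d p (nu n \<omega>) k))"
    and "centered_O1 M (\<lambda>n \<omega>. fst (snd (fluct d p (nu n \<omega>) k)))"
    and "centered_O1 M (\<lambda>n \<omega>. snd (snd (fluct d p (nu n \<omega>) k)))"
proof -
  have "centered_O1 M (\<lambda>n \<omega>. fst (fluct d p (nu n \<omega>) k)) \<and>
    centered_O1 M (\<lambda>n \<omega>. fst (snd (fluct d p (nu n \<omega>) k))) \<and>
    centered_O1 M (\<lambda>n \<omega>. snd (snd (fluct d p (nu n \<omega>) k)))"
    using assms
  proof (induction k)
    case 0
    then show ?case
      by (cases p) (auto intro: centered_O1_zero)
  next
    case (Suc k)
    then have "centered_O1 M (\<lambda>n \<omega>. fst (fluct d p (nu n \<omega>) k))"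
      "centered_O1 M (\<lambda>n \<omega>. fst (snd (fluct d p (nu n \<omega>) k)))"
      "centered_O1 M (\<lambda>n \<omega>. snd (snd (fluct d p (nu n \<omega>) k)))"
      "centered_O1 M (\<lambda>n \<omega>. nu n \<omega> (Suc k))"
      "centered_O1 M (\<lambda>n \<omega>. if p then nu n \<omega> (Suc k) else 0)"
      by (cases p; auto intro: centered_O1_zero)+
    then show ?case
      unfolding fluct.simps case_prod_beta fst_conv snd_conv
      by (intro conjI centered_O1_intros)
  qed
  then show "centered_O1 M (\<lambda>n \<omega>. fst (fluct d p (nu n \<omega>) k))"
    and "centered_O1 M (\<lambda>n \<omega>. fst (snd (fluct d p (nu n \<omega>) k)))"
    and "centered_O1 M (\<lambda>n \<omega>. snd (snd (fluct d p (nu n \<omega>) k)))" by auto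
qed

section \<open>Expectations determined up to \<open>O(1/n)\<close>\<close>

text \<open>The parameter \<open>l\<close> is a realization of the leader's noise; the bound is uniform in it,
  because no moments of that noise are available.\<close>

definition mean_O1 :: "(nat \<Rightarrow> 'w measure) \<Rightarrow> ('l \<Rightarrow> nat \<Rightarrow> 'w \<Rightarrow> real) \<Rightarrow> ('l \<Rightarrow> real) \<Rightarrow> bool" where
  "mean_O1 M f c \<longleftrightarrow> (\<exists>K\<ge>0. \<forall>n\<ge>1. \<forall>l. integrable (M n) (f l n) \<and>
     \<bar>integral\<^sup>L (M n) (f l n) - c l\<bar> \<le> K / real n)"

lemma mean_O1_add:
  assumes "mean_O1 M f c" "mean_O1 M g e"
  shows "mean_O1 M (\<lambda>l n \<omega>. f l n \<omega> + g l n \<omega>) (\<lambda>l. c l + e l)"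
proof -
  obtain K where K: "K \<ge> 0" and f: "\<And>n l. n \<ge> 1 \<Longrightarrow> integrable (M n) (f l n)"
     "\<And>n l. n \<ge> 1 \<Longrightarrow> \<bar>integral\<^sup>L (M n) (f l n) - c l\<bar> \<le> K / real n"
    using assms(1) unfolding mean_O1_def by blast
  obtain L where L: "L \<ge> 0" and g: "\<And>n l. n \<ge> 1 \<Longrightarrow> integrable (M n) (g l n)"
     "\<And>n l. n \<ge> 1 \<Longrightarrow> \<bar>integral\<^sup>L (M n) (g l n) - e l\<bar> \<le> L / real n"
    using assms(2) unfolding mean_O1_def by blast
  have "\<bar>(\<integral>\<omega>. f l n \<omega> + g l n \<omega> \<partial>M n) - (c l + e l)\<bar> \<le> (K + L) / real n" if n: "n \<ge> 1" for n l
    using f[OF n, of l] g[OF n, of l] by (simp add: add_divide_distrib)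
  then show ?thesis
    unfolding mean_O1_def using f(1) g(1) K L by (intro exI[of _ "K + L"]) auto
qed

lemma mean_O1_sum:
  assumes "finite I" "\<And>i. i \<in> I \<Longrightarrow> mean_O1 M (f i) (c i)"
  shows "mean_O1 M (\<lambda>l n \<omega>. \<Sum>i\<in>I. f i l n \<omega>) (\<lambda>l. \<Sum>i\<in>I. c i l)"
  using assms
proof (induction I)
  case empty
  show ?case unfolding mean_O1_def by (auto intro!: exI[of _ 0])
qed (auto intro: mean_O1_add)

text \<open>For fixed \<open>l\<close> the cross terms are linear in the centered \<open>V n\<close>
  and integrate to zero, so \<open>c l\<close> does not enter the bound. Mere estimates of them
  would give order \<open>norm (c l) / sqrt n\<close>, neither uniform in \<open>l\<close> nor good
  enough in \<open>n\<close>. Only \<open>quad A (V n \<omega>)\<close> remains, bounded through the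
  operator norm.\<close>

lemma mean_O1_quad:
  assumes M: "\<And>n. n \<ge> 1 \<Longrightarrow> prob_space (M n)" and "centered_O1 M V"
  shows "mean_O1 M (\<lambda>l n \<omega>. quad A (c l + V n \<omega>)) (\<lambda>l. quad A (c l))"
proof -
  obtain K where K: "K \<ge> 0" and V: "\<And>n. n \<ge> 1 \<Longrightarrow> integrable (M n) (V n)"
     "\<And>n. n \<ge> 1 \<Longrightarrow> integral\<^sup>L (M n) (V n) = 0"
     "\<And>n. n \<ge> 1 \<Longrightarrow> integrable (M n) (\<lambda>\<omega>. (norm (V n \<omega>))\<^sup>2)"
     "\<And>n. n \<ge> 1 \<Longrightarrow> (\<integral>\<omega>. (norm (V n \<omega>))\<^sup>2 \<partial>M n) \<le> K / real n"
    using assms unfolding centered_O1_def by blast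
  define a where "a = onorm ((*v) A)"
  have a: "a \<ge> 0" by (simp add: a_def onorm_pos_le)
  have "integrable (M n) (\<lambda>\<omega>. quad A (c l + V n \<omega>)) \<and>
      \<bar>(\<integral>\<omega>. quad A (c l + V n \<omega>) \<partial>M n) - quad A (c l)\<bar> \<le> (a * K) / real n" if n: "n \<ge> 1" for n l
  proof -
    interpret prob_space "M n" using M[OF n] .
    have [measurable]: "V n \<in> borel_measurable (M n)" using V(1)[OF n] by auto
    have AV: "integrable (M n) (\<lambda>\<omega>. A *v V n \<omega>)" "(\<integral>\<omega>. A *v V n \<omega> \<partial>M n) = 0"
      using integrable_bounded_linear[OF _ V(1)[OF n], of "(*v) A"]
        integral_bounded_linear[OF _ V(1)[OF n], of "(*v) A"] V(2)[OF n] by auto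
    have i1: "integrable (M n) (\<lambda>\<omega>. c l \<bullet> (A *v V n \<omega>))" "(\<integral>\<omega>. c l \<bullet> (A *v V n \<omega>) \<partial>M n) = 0"
      using AV by (auto simp: integral_inner_right)
    have i2: "integrable (M n) (\<lambda>\<omega>. V n \<omega> \<bullet> (A *v c l))" "(\<integral>\<omega>. V n \<omega> \<bullet> (A *v c l) \<partial>M n) = 0"
      using V(1,2)[OF n] by (auto simp: integral_inner_left)
    have le: "\<bar>quad A (V n \<omega>)\<bar> \<le> a * (norm (V n \<omega>))\<^sup>2" for \<omega>
      unfolding a_def by (rule abs_quad_le)
    have i3: "integrable (M n) (\<lambda>\<omega>. quad A (V n \<omega>))"
      by (rule Bochner_Integration.integrable_bound[of _ "\<lambda>\<omega>. a * (norm (V n \<omega>))\<^sup>2"])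
         (use V(3)[OF n] le a in auto)
    have "\<bar>\<integral>\<omega>. quad A (V n \<omega>) \<partial>M n\<bar> \<le> (\<integral>\<omega>. \<bar>quad A (V n \<omega>)\<bar> \<partial>M n)"
      by (rule integral_abs_bound)
    also have "\<dots> \<le> (\<integral>\<omega>. a * (norm (V n \<omega>))\<^sup>2 \<partial>M n)"
      by (rule integral_mono) (use i3 V(3)[OF n] le in auto)
    also have "\<dots> \<le> a * (K / real n)"
      using mult_left_mono[OF V(4)[OF n] a] by simp
    finally show ?thesis
      using i1 i2 i3 by (simp add: quad_add prob_space)
  qed
  then show ?thesis
    unfolding mean_O1_def using K a by (intro exI[of _ "a * K"]) auto
qed

text \<open>The decisive point is that the limit on the right is free of \<open>p\<close>: both
  feedback laws have the same nominal cost for every realization of the leader's noise.\<close>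

lemma mean_O1_mean_cost:
  fixes d :: "('x::finite, 'u::finite) lq_data"
  assumes M: "\<And>n. n \<ge> 1 \<Longrightarrow> prob_space (M n)"
    and nu: "\<And>k. k < hor d \<Longrightarrow> centered_O1 M (\<lambda>n \<omega>. nu n \<omega> k)"
  shows "mean_O1 M (\<lambda>l n \<omega>. mean_cost d (nominal d mu l) (fluct d p (nu n \<omega>)))
    (\<lambda>l. mean_cost d (nominal d mu l) (\<lambda>k. (0, 0, 0)))"
proof -
  have fl: "centered_O1 M (\<lambda>n \<omega>. fst (fluct d p (nu n \<omega>) k))"
    "centered_O1 M (\<lambda>n \<omega>. fst (snd (fluct d p (nu n \<omega>) k)))"
    "centered_O1 M (\<lambda>n \<omega>. snd (snd (fluct d p (nu n \<omega>) k)))" if "k < hor d" for k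
    using centered_O1_fluct[of k M nu d p] nu that by auto
  have diff: "b + b' - (a + a') = (b - a) + (b' - a')" for a a' b b' :: "real^'x" by simp
  have cost: "mean_cost d (nominal d mu l) (\<lambda>k. (0, 0, 0)) =
    (\<Sum>k<hor d. mean_stage d (Suc k) (fst (nominal d mu l k)) (snd (nominal d mu l k))
       (L11 d (Suc k) *v fst (nominal d mu l k) + L12 d (Suc k) *v snd (nominal d mu l k))
       (L21 d (Suc k) *v fst (nominal d mu l k) + L22 d (Suc k) *v snd (nominal d mu l k)))" for l
    by (simp add: mean_cost_def case_prod_beta matrix_vector_mult_0_right)
  show ?thesis
    unfolding cost mean_cost_def[of d "nominal d mu _" "fluct d p _"] mean_stage_def
      case_prod_beta fst_conv snd_conv diff
    by (intro mean_O1_sum mean_O1_add mean_O1_quad[OF M] centered_O1_add centered_O1_diff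
        centered_O1_matrix fl finite_lessThan) auto
qed

section \<open>Independence\<close>

text \<open>Proved coordinate by coordinate from the product rule for independent real
  variables.\<close>

lemma (in prob_space) inner_indep_vars:
  fixes X :: "'i \<Rightarrow> 'a \<Rightarrow> real^'x"
  assumes indep: "indep_vars (\<lambda>_. borel) X I" and ij: "i \<in> I" "j \<in> I" "i \<noteq> j"
    and int: "integrable M (X i)" "integrable M (X j)"
  shows "integrable M (\<lambda>\<omega>. X i \<omega> \<bullet> X j \<omega>)"
    and "(\<integral>\<omega>. X i \<omega> \<bullet> X j \<omega> \<partial>M) = integral\<^sup>L M (X i) \<bullet> integral\<^sup>L M (X j)"
proof -
  have nth: "(\<lambda>x::real^'x. x $ a) \<in> borel_measurable borel" for a
    by (intro borel_measurable_continuous_onI continuous_intros)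
  have ind: "indep_var borel (\<lambda>\<omega>. X i \<omega> $ a) borel (\<lambda>\<omega>. X j \<omega> $ a)" for a
  proof -
    \<comment> \<open>The disjoint blocks \<open>{i}\<close> and \<open>{j}\<close> are independent,
      and a coordinate is a measurable function of its block.\<close>
    have "indep_var borel ((\<lambda>f. f i $ a) \<circ> (\<lambda>\<omega>. restrict (\<lambda>i. X i \<omega>) {i}))
        borel ((\<lambda>f. f j $ a) \<circ> (\<lambda>\<omega>. restrict (\<lambda>i. X i \<omega>) {j}))"
      using ij by (intro indep_var_compose[OF indep_var_restrict[OF indep]]
          measurable_compose[OF _ nth] measurable_component_singleton) auto
    then show ?thesis by (simp add: comp_def)
  qed
  have int': "integrable M (\<lambda>\<omega>. X i \<omega> $ a)" "integrable M (\<lambda>\<omega>. X j \<omega> $ a)"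
    and nth_int: "(\<integral>\<omega>. X i \<omega> $ a \<partial>M) = integral\<^sup>L M (X i) $ a"
      "(\<integral>\<omega>. X j \<omega> $ a \<partial>M) = integral\<^sup>L M (X j) $ a" for a
    using integrable_bounded_linear[OF bounded_linear_vec_nth[of a]]
      integral_bounded_linear[OF bounded_linear_vec_nth[of a]] int by auto
  note prod = indep_var_integrable[OF ind int'] indep_var_lebesgue_integral[OF ind int']
  show "integrable M (\<lambda>\<omega>. X i \<omega> \<bullet> X j \<omega>)"
    unfolding inner_vec_def inner_real_def using prod by auto
  show "(\<integral>\<omega>. X i \<omega> \<bullet> X j \<omega> \<partial>M) = integral\<^sup>L M (X i) \<bullet> integral\<^sup>L M (X j)"
    unfolding inner_vec_def inner_real_def using prod
    by (subst Bochner_Integration.integral_sum) (auto simp: nth_int)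
qed

text \<open>Bienayme's identity for vectors: after expanding the squared norm, the off-diagonal
  inner products have mean zero.\<close>

lemma (in prob_space) norm_sum_indep_vars:
  fixes X :: "'i \<Rightarrow> 'a \<Rightarrow> real^'x"
  assumes I: "finite I" and indep: "indep_vars (\<lambda>_. borel) X I"
    and int: "\<And>i. i \<in> I \<Longrightarrow> integrable M (X i)" "\<And>i. i \<in> I \<Longrightarrow> integral\<^sup>L M (X i) = 0"
      "\<And>i. i \<in> I \<Longrightarrow> integrable M (\<lambda>\<omega>. (norm (X i \<omega>))\<^sup>2)"
  shows "integrable M (\<lambda>\<omega>. (norm (\<Sum>i\<in>I. X i \<omega>))\<^sup>2)"
    and "(\<integral>\<omega>. (norm (\<Sum>i\<in>I. X i \<omega>))\<^sup>2 \<partial>M) = (\<Sum>i\<in>I. \<integral>\<omega>. (norm (X i \<omega>))\<^sup>2 \<partial>M)"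
proof -
  have eq: "(norm (\<Sum>i\<in>I. X i \<omega>))\<^sup>2 = (\<Sum>i\<in>I. \<Sum>j\<in>I. X i \<omega> \<bullet> X j \<omega>)" for \<omega>
    by (simp only: power2_norm_eq_inner inner_sum_left) (simp only: inner_sum_right)
  have int': "integrable M (\<lambda>\<omega>. X i \<omega> \<bullet> X j \<omega>)" if "i \<in> I" "j \<in> I" for i j
    using that int inner_indep_vars(1)[OF indep that]
    by (cases "i = j") (auto simp: power2_norm_eq_inner[symmetric])
  show "integrable M (\<lambda>\<omega>. (norm (\<Sum>i\<in>I. X i \<omega>))\<^sup>2)"
    unfolding eq using int' by auto
  have "(\<integral>\<omega>. (norm (\<Sum>i\<in>I. X i \<omega>))\<^sup>2 \<partial>M) = (\<Sum>i\<in>I. \<Sum>j\<in>I. \<integral>\<omega>. X i \<omega> \<bullet> X j \<omega> \<partial>M)"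
    unfolding eq using int' by (simp add: Bochner_Integration.integral_sum)
  also have "\<dots> = (\<Sum>i\<in>I. \<Sum>j\<in>I. if i = j then \<integral>\<omega>. (norm (X i \<omega>))\<^sup>2 \<partial>M else 0)"
    using int inner_indep_vars(2)[OF indep]
    by (intro sum.cong refl) (auto simp: power2_norm_eq_inner)
  finally show "(\<integral>\<omega>. (norm (\<Sum>i\<in>I. X i \<omega>))\<^sup>2 \<partial>M) = (\<Sum>i\<in>I. \<integral>\<omega>. (norm (X i \<omega>))\<^sup>2 \<partial>M)"
    using I by simp
qed

text \<open>Tonelli's theorem for the joint law, a product by independence, pulled back to the
  underlying space: \<open>\<omega>'\<close> plays the role of an independent copy. Infinite values
  are allowed.\<close>

lemma (in prob_space) nn_integral_indep_var:
  assumes indep: "indep_var S X T Y" and f[measurable]: "f \<in> borel_measurable (S \<Otimes>\<^sub>M T)"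
  shows "(\<integral>\<^sup>+\<omega>. f (X \<omega>, Y \<omega>) \<partial>M) = (\<integral>\<^sup>+\<omega>. \<integral>\<^sup>+\<omega>'. f (X \<omega>, Y \<omega>') \<partial>M \<partial>M)"
    and "(\<lambda>\<omega>. \<integral>\<^sup>+\<omega>'. f (X \<omega>, Y \<omega>') \<partial>M) \<in> borel_measurable M"
proof -
  have X[measurable]: "X \<in> measurable M S" and Y[measurable]: "Y \<in> measurable M T"
    and eq: "distr M S X \<Otimes>\<^sub>M distr M T Y = distr M (S \<Otimes>\<^sub>M T) (\<lambda>x. (X x, Y x))"
    using indep unfolding indep_var_distribution_eq by auto
  interpret Y: prob_space "distr M T Y" by (rule prob_space_distr) fact
  have inner: "(\<integral>\<^sup>+y. f (x, y) \<partial>distr M T Y) = (\<integral>\<^sup>+\<omega>'. f (x, Y \<omega>') \<partial>M)" if "x \<in> space S" for x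
    using that by (intro nn_integral_distr) auto
  have meas: "(\<lambda>x. \<integral>\<^sup>+y. f (x, y) \<partial>distr M T Y) \<in> borel_measurable S"
    by measurable
  have "(\<integral>\<^sup>+\<omega>. f (X \<omega>, Y \<omega>) \<partial>M) = integral\<^sup>N (distr M (S \<Otimes>\<^sub>M T) (\<lambda>x. (X x, Y x))) f"
    by (subst nn_integral_distr) auto
  also have "\<dots> = (\<integral>\<^sup>+x. \<integral>\<^sup>+y. f (x, y) \<partial>distr M T Y \<partial>distr M S X)"
    unfolding eq[symmetric] by (subst Y.nn_integral_fst) auto
  also have "\<dots> = (\<integral>\<^sup>+\<omega>. \<integral>\<^sup>+y. f (X \<omega>, y) \<partial>distr M T Y \<partial>M)"
    by (rule nn_integral_distr[OF X]) (use meas in simp)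
  also have "\<dots> = (\<integral>\<^sup>+\<omega>. \<integral>\<^sup>+\<omega>'. f (X \<omega>, Y \<omega>') \<partial>M \<partial>M)"
    using measurable_space[OF X] by (intro nn_integral_cong inner) auto
  finally show "(\<integral>\<^sup>+\<omega>. f (X \<omega>, Y \<omega>) \<partial>M) = (\<integral>\<^sup>+\<omega>. \<integral>\<^sup>+\<omega>'. f (X \<omega>, Y \<omega>') \<partial>M \<partial>M)" .
  have "(\<lambda>\<omega>. \<integral>\<^sup>+y. f (X \<omega>, y) \<partial>distr M T Y) \<in> borel_measurable M"
    using measurable_compose[OF X meas] .
  also have "?this \<longleftrightarrow> (\<lambda>\<omega>. \<integral>\<^sup>+\<omega>'. f (X \<omega>, Y \<omega>') \<partial>M) \<in> borel_measurable M"
    using measurable_space[OF X] by (intro measurable_cong inner) auto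
  finally show "(\<lambda>\<omega>. \<integral>\<^sup>+\<omega>'. f (X \<omega>, Y \<omega>') \<partial>M) \<in> borel_measurable M" .
qed

section \<open>The primitive random variables\<close>

text \<open>Treating the initial state as noise at time \<open>0\<close> yields a single independent
  family and matches the indexing of \<open>nominal\<close>, \<open>fluct\<close> and
  \<open>deviation\<close>.\<close>

definition inputs :: "('w, 'x::finite) randomness \<Rightarrow> nat \<times> nat \<Rightarrow> 'w \<Rightarrow> real^'x" where
  "inputs S = (\<lambda>(i, t). if t = 0 then init S i else noise S i t)"

abbreviation leader_inputs :: "nat \<Rightarrow> ('w, 'x::finite) randomness \<Rightarrow> 'w \<Rightarrow> nat \<times> nat \<Rightarrow> real^'x" where
  "leader_inputs T S \<omega> \<equiv> restrict (\<lambda>j. inputs S j \<omega>) ({0} \<times> {0..T})"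

abbreviation follower_inputs ::
  "nat \<Rightarrow> nat \<Rightarrow> ('w, 'x::finite) randomness \<Rightarrow> 'w \<Rightarrow> nat \<times> nat \<Rightarrow> real^'x" where
  "follower_inputs n T S \<omega> \<equiv> restrict (\<lambda>j. inputs S j \<omega>) ({1..n} \<times> {0..T})"

lemma mutually_independent_iff:
  "mutually_independent n T S \<longleftrightarrow>
     prob_space.indep_vars (Om S) (\<lambda>_. borel) (inputs S) ({0..n} \<times> {0..T})"
  by (simp add: mutually_independent_def inputs_def)

lemma mean_noise_cong:
  "(\<And>i. i \<in> {1..n} \<Longrightarrow> v i k = v' i k) \<Longrightarrow> mean_noise n mu v k = mean_noise n mu v' k"
  by (simp add: mean_noise_def mean_field_def)

lemma dev_cost_cong:
  assumes "\<And>i k. i \<in> {1..n} \<Longrightarrow> v i k = v' i k"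
  shows "dev_cost d n v = dev_cost d n v'"
proof -
  have "mean_field n (\<lambda>i. v i k) = mean_field n (\<lambda>i. v' i k)" for k
    using assms by (simp add: mean_field_def)
  then have "dev_noise n v i = dev_noise n v' i" if "i \<in> {1..n}" for i
    using assms that by (auto simp: dev_noise_def fun_eq_iff)
  then show ?thesis
    by (simp add: dev_cost_def)
qed

text \<open>The only place where the factor \<open>1 / n\<close> arises: an average of
  \<open>n\<close> independent centered vectors has second moment
  \<open>n * K / n^2\<close>.\<close>

lemma centered_O1_mean_noise:
  fixes S :: "nat \<Rightarrow> ('w, 'x::finite) randomness"
  assumes prob: "\<And>n. n \<ge> 1 \<Longrightarrow> prob_space (Om (S n))"
    and indep: "\<And>n. n \<ge> 1 \<Longrightarrow> mutually_independent n T (S n)"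
    and init: "\<And>n i. n \<ge> 1 \<Longrightarrow> i \<in> {1..n} \<Longrightarrow> has_mean_cov (Om (S n)) (init (S n) i) mu Sigma_x"
    and noise: "\<And>n i t. n \<ge> 1 \<Longrightarrow> i \<in> {1..n} \<Longrightarrow> t \<in> {1..T} \<Longrightarrow>
        has_mean_cov (Om (S n)) (noise (S n) i t) 0 Sigma_w"
    and k: "k \<le> T"
  shows "centered_O1 (\<lambda>n. Om (S n)) (\<lambda>n \<omega>. mean_noise n mu (\<lambda>i k. follower_inputs n T (S n) \<omega> (i, k)) k)"
proof -
  define m where "m = (if k = 0 then mu else 0)"
  define C where "C = (if k = 0 then Sigma_x else Sigma_w)"
  \<comment> \<open>The trace of the covariance is the second moment of the norm of one centered
    input.\<close>
  define K where "K = (\<Sum>a\<in>UNIV. C $ a $ a)"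
  define X where "X n i \<omega> = inputs (S n) (i, k) \<omega> - m" for n i \<omega>
  have cov: "has_mean_cov (Om (S n)) (inputs (S n) (i, k)) m C" if "n \<ge> 1" "i \<in> {1..n}" for n i
    using init[OF that] noise[OF that, of k] k by (auto simp: inputs_def m_def C_def)
  have sq: "(norm (X n i \<omega>))\<^sup>2 = (\<Sum>a\<in>UNIV. (inputs (S n) (i, k) \<omega> $ a - m $ a) * (inputs (S n) (i, k) \<omega> $ a - m $ a))"
    for n i \<omega>
    by (simp add: X_def power2_norm_eq_inner inner_vec_def)
  have X: "integrable (Om (S n)) (X n i)" "integral\<^sup>L (Om (S n)) (X n i) = 0"
    "integrable (Om (S n)) (\<lambda>\<omega>. (norm (X n i \<omega>))\<^sup>2)" "(\<integral>\<omega>. (norm (X n i \<omega>))\<^sup>2 \<partial>Om (S n)) = K"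
    if n: "n \<ge> 1" and i: "i \<in> {1..n}" for n i
  proof -
    interpret prob_space "Om (S n)" using prob[OF n] .
    note c = cov[OF n i, unfolded has_mean_cov_def]
    show "integrable (Om (S n)) (X n i)" "integral\<^sup>L (Om (S n)) (X n i) = 0"
      unfolding X_def using c by (auto simp: prob_space)
    show "integrable (Om (S n)) (\<lambda>\<omega>. (norm (X n i \<omega>))\<^sup>2)"
      unfolding sq using c by auto
    show "(\<integral>\<omega>. (norm (X n i \<omega>))\<^sup>2 \<partial>Om (S n)) = K"
      unfolding sq K_def using c by (subst Bochner_Integration.integral_sum) auto
  qed
  have noise_eq: "mean_noise n mu (\<lambda>i k. follower_inputs n T (S n) \<omega> (i, k)) k = (1 / real n) *\<^sub>R (\<Sum>i=1..n. X n i \<omega>)"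
    if n: "n \<ge> 1" for n \<omega>
  proof -
    have "mean_noise n mu (\<lambda>i k. follower_inputs n T (S n) \<omega> (i, k)) k
      = mean_field n (\<lambda>i. inputs (S n) (i, k) \<omega>) - m"
      using k by (simp add: mean_noise_def mean_field_def m_def)
    also have "\<dots> = mean_field n (\<lambda>i. X n i \<omega> + m) - m"
      by (simp add: X_def)
    also have "\<dots> = mean_field n (\<lambda>i. X n i \<omega>)"
      using n by (simp only: mean_field_add mean_field_const[OF n]) simp
    finally show ?thesis
      by (simp add: mean_field_def)
  qed
  \<comment> \<open>The sign of the trace is read off from a second moment in the model with one
    follower.\<close>
  have K: "K \<ge> 0"
  proof -
    have "0 \<le> (\<integral>\<omega>. (norm (X 1 1 \<omega>))\<^sup>2 \<partial>Om (S 1))" by simp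
    also have "\<dots> = K" by (rule X(4)) auto
    finally show ?thesis .
  qed
  let ?V = "\<lambda>n \<omega>. (1 / real n) *\<^sub>R (\<Sum>i=1..n. X n i \<omega>)"
  have "integrable (Om (S n)) (?V n) \<and> integral\<^sup>L (Om (S n)) (?V n) = 0 \<and>
    integrable (Om (S n)) (\<lambda>\<omega>. (norm (?V n \<omega>))\<^sup>2) \<and>
    (\<integral>\<omega>. (norm (?V n \<omega>))\<^sup>2 \<partial>Om (S n)) \<le> K / real n" if n: "n \<ge> 1" for n
  proof (intro conjI)
    interpret prob_space "Om (S n)" using prob[OF n] .
    have "indep_vars (\<lambda>_. borel) (inputs (S n)) ((\<lambda>i. (i, k)) ` {1..n})"
      using indep[OF n] unfolding mutually_independent_iff
      by (rule indep_vars_subset) (use k in auto)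
    then have ind: "indep_vars (\<lambda>_. borel) (\<lambda>j \<omega>. inputs (S n) j \<omega> - m) ((\<lambda>i. (i, k)) ` {1..n})"
      by (rule indep_vars_compose2[where Y = "\<lambda>_ x. x - m"]) auto
    have inj: "inj_on (\<lambda>i. (i, k)) {1..n}" by (auto intro: inj_onI)
    have sum: "integrable (Om (S n)) (\<lambda>\<omega>. (norm (\<Sum>i=1..n. X n i \<omega>))\<^sup>2)"
      "(\<integral>\<omega>. (norm (\<Sum>i=1..n. X n i \<omega>))\<^sup>2 \<partial>Om (S n)) = real n * K"
    proof -
      have Z: "integrable (Om (S n)) (\<lambda>\<omega>. inputs (S n) j \<omega> - m)"
        "(\<integral>\<omega>. inputs (S n) j \<omega> - m \<partial>Om (S n)) = 0"
        "integrable (Om (S n)) (\<lambda>\<omega>. (norm (inputs (S n) j \<omega> - m))\<^sup>2)"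
        "(\<integral>\<omega>. (norm (inputs (S n) j \<omega> - m))\<^sup>2 \<partial>Om (S n)) = K"
        if "j \<in> (\<lambda>i. (i, k)) ` {1..n}" for j
        using that X[OF n] by (auto simp: X_def[abs_def])
      show "integrable (Om (S n)) (\<lambda>\<omega>. (norm (\<Sum>i=1..n. X n i \<omega>))\<^sup>2)"
        "(\<integral>\<omega>. (norm (\<Sum>i=1..n. X n i \<omega>))\<^sup>2 \<partial>Om (S n)) = real n * K"
        using norm_sum_indep_vars[OF _ ind Z(1-3)] Z(4)
        by (simp_all add: sum.reindex[OF inj] card_image[OF inj] X_def comp_def del: One_nat_def)
    qed
    show "integrable (Om (S n)) (?V n)"
      by (intro integrable_scaleR_right Bochner_Integration.integrable_sum X(1)[OF n])
    show "integral\<^sup>L (Om (S n)) (?V n) = 0"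
      using X(1,2)[OF n] by (simp add: Bochner_Integration.integral_sum)
    have sq: "(norm (?V n \<omega>))\<^sup>2 = (1 / (real n)\<^sup>2) * (norm (\<Sum>i=1..n. X n i \<omega>))\<^sup>2" for \<omega>
      by (simp add: power_divide)
    show "integrable (Om (S n)) (\<lambda>\<omega>. (norm (?V n \<omega>))\<^sup>2)"
      unfolding sq using sum(1) by (rule integrable_mult_right)
    show "(\<integral>\<omega>. (norm (?V n \<omega>))\<^sup>2 \<partial>Om (S n)) \<le> K / real n"
      unfolding sq integral_mult_right_zero sum(2) using n by (simp add: power2_eq_square)
  qed
  then show ?thesis
    unfolding centered_O1_def using K noise_eq by (intro exI[of _ K]) (auto cong: Bochner_Integration.integrable_cong)
qed

section \<open>Comparison of the two feedback laws\<close>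

definition split_cost ::
  "('x::finite, 'u::finite) lq_data \<Rightarrow> nat \<Rightarrow> real^'x \<Rightarrow> bool \<Rightarrow>
    (nat \<times> nat \<Rightarrow> real^'x) \<Rightarrow> (nat \<times> nat \<Rightarrow> real^'x) \<Rightarrow> real" where
  "split_cost d n mu p x y =
     mean_cost d (nominal d mu (\<lambda>k. x (0, k))) (fluct d p (mean_noise n mu (\<lambda>i k. y (i, k))))
     + dev_cost d n (\<lambda>i k. y (i, k))"

text \<open>The leader's and the followers' inputs are disjoint blocks of the independent family, so
  the inner integral freezes the leader's noise. The measurability claim serves to add a constant
  under the outer integral.\<close>

lemma J_signal_law:
  fixes d :: "('x::finite, 'u::finite) lq_data"
  assumes n: "n \<ge> 1" and prob: "prob_space (Om S)" and indep: "mutually_independent n (hor d) S"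
  shows "J d n mu S (signal_law d p) = (\<integral>\<^sup>+\<omega>. \<integral>\<^sup>+\<omega>'. ennreal (split_cost d n mu p
       (leader_inputs (hor d) S \<omega>) (follower_inputs n (hor d) S \<omega>')) \<partial>Om S \<partial>Om S)"
    and "(\<lambda>\<omega>. \<integral>\<^sup>+\<omega>'. ennreal (split_cost d n mu p
       (leader_inputs (hor d) S \<omega>) (follower_inputs n (hor d) S \<omega>')) \<partial>Om S) \<in> borel_measurable (Om S)"
proof -
  interpret prob_space "Om S" by fact
  let ?A = "{0} \<times> {0..hor d} :: (nat \<times> nat) set" and ?B = "{1..n} \<times> {0..hor d}"
  let ?X = "leader_inputs (hor d) S" and ?Y = "follower_inputs n (hor d) S"
  have ind: "indep_var (PiM ?A (\<lambda>_. borel)) ?X (PiM ?B (\<lambda>_. borel)) ?Y"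
    using indep unfolding mutually_independent_iff by (rule indep_var_restrict) auto
  have x: "(\<lambda>z. fst z (0, k)) \<in> borel_measurable (PiM ?A (\<lambda>_. borel) \<Otimes>\<^sub>M PiM ?B (\<lambda>_. borel :: (real^'x) measure))"
    if "k < hor d" for k
    using that by (intro measurable_compose[OF measurable_fst] measurable_component_singleton) auto
  have y: "(\<lambda>z. snd z (i, k)) \<in> borel_measurable (PiM ?A (\<lambda>_. borel :: (real^'x) measure) \<Otimes>\<^sub>M PiM ?B (\<lambda>_. borel))"
    if "i \<in> {1..n}" "k < hor d" for i k
    using that by (intro measurable_compose[OF measurable_snd] measurable_component_singleton) auto
  have meas: "(\<lambda>z. ennreal (split_cost d n mu p (fst z) (snd z)))
      \<in> borel_measurable (PiM ?A (\<lambda>_. borel) \<Otimes>\<^sub>M PiM ?B (\<lambda>_. borel))"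
    unfolding split_cost_def using x y
    by (intro measurable_compose[OF _ measurable_ennreal] borel_measurable_add
        borel_measurable_mean_cost borel_measurable_mean_noise borel_measurable_dev_cost) auto
  have cost: "path_cost d n mu (signal_law d p) (\<lambda>i. init S i \<omega>) (\<lambda>i t. noise S i t \<omega>)
      = split_cost d n mu p (?X \<omega>) (?Y \<omega>)" for \<omega>
  proof -
    \<comment> \<open>Glues the two restricted families together; outside the blocks
      \<open>v\<close> takes arbitrary values, which the congruence lemmas discard.\<close>
    define v where "v i k = (if i = 0 then ?X \<omega> (0, k) else ?Y \<omega> (i, k))" for i k
    have "path_cost d n mu (signal_law d p) (\<lambda>i. init S i \<omega>) (\<lambda>i t. noise S i t \<omega>)
      = path_cost d n mu (signal_law d p) (\<lambda>i. v i 0) v"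
      by (rule path_cost_cong) (auto simp: v_def inputs_def)
    also have "\<dots> = mean_cost d (nominal d mu (v 0)) (fluct d p (mean_noise n mu v)) + dev_cost d n v"
      by (rule path_cost_signal_law[OF n])
    also have "mean_noise n mu v = mean_noise n mu (\<lambda>i k. ?Y \<omega> (i, k))"
      by (intro ext mean_noise_cong) (simp add: v_def)
    also have "dev_cost d n v = dev_cost d n (\<lambda>i k. ?Y \<omega> (i, k))"
      by (intro dev_cost_cong) (simp add: v_def)
    also have "v 0 = (\<lambda>k. ?X \<omega> (0, k))"
      by (simp add: v_def fun_eq_iff)
    finally show ?thesis
      by (simp add: split_cost_def)
  qed
  show "J d n mu S (signal_law d p) =
      (\<integral>\<^sup>+\<omega>. \<integral>\<^sup>+\<omega>'. ennreal (split_cost d n mu p (?X \<omega>) (?Y \<omega>')) \<partial>Om S \<partial>Om S)"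
    unfolding J_def cost using nn_integral_indep_var(1)[OF ind meas] by simp
  show "(\<lambda>\<omega>. \<integral>\<^sup>+\<omega>'. ennreal (split_cost d n mu p (?X \<omega>) (?Y \<omega>')) \<partial>Om S) \<in> borel_measurable (Om S)"
    using nn_integral_indep_var(2)[OF ind meas] by simp
qed

lemma mean_cost_nonneg:
  assumes "\<forall>t\<in>{1..hor d}. pos_semidef (Qbar d t) \<and> pos_def (mR d t) \<and> pos_def (mR0 d t)"
  shows "mean_cost d c f \<ge> 0"
  unfolding mean_cost_def case_prod_beta using assms
  by (intro sum_nonneg mean_stage_nonneg) auto

lemma dev_cost_nonneg:
  assumes "\<forall>t\<in>{1..hor d}. pos_semidef (mQ d t + mP d t + mH d t) \<and> pos_def (mR d t)"
  shows "dev_cost d n v \<ge> 0"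
proof -
  have "quad (mQ d (Suc k) + mP d (Suc k) + mH d (Suc k)) x \<ge> 0" "quad (mR d (Suc k)) y \<ge> 0"
    if "k < hor d" for k x y
    using bspec[OF assms, of "Suc k"] that by (auto simp: pos_semidef_def intro: pos_def_imp_quad_nonneg)
  then show ?thesis
    unfolding dev_cost_def by (intro sum_nonneg mult_nonneg_nonneg add_nonneg_nonneg) auto
qed

text \<open>For frozen leader's noise the mean part has a finite integral and obeys the uniform
  bound, while the deviation part is one and the same extended number on both sides. The outer
  integral then preserves the inequality, even when the costs are infinite.\<close>

lemma J_signal_law_le:
  fixes d :: "('x::finite, 'u::finite) lq_data" and S :: "nat \<Rightarrow> ('w, 'x) randomness"
  assumes definite: "\<forall>t\<in>{1..hor d}.
        pos_semidef (mQ d t + mP d t + mH d t) \<and> pos_semidef (Qbar d t) \<and>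
        pos_def (mR d t) \<and> pos_def (mR0 d t)"
    and prob: "\<And>n. n \<ge> 1 \<Longrightarrow> prob_space (Om (S n))"
    and indep: "\<And>n. n \<ge> 1 \<Longrightarrow> mutually_independent n (hor d) (S n)"
    and init: "\<And>n i. n \<ge> 1 \<Longrightarrow> i \<in> {1..n} \<Longrightarrow> has_mean_cov (Om (S n)) (init (S n) i) mu Sigma_x"
    and noise: "\<And>n i t. n \<ge> 1 \<Longrightarrow> i \<in> {1..n} \<Longrightarrow> t \<in> {1..hor d} \<Longrightarrow>
        has_mean_cov (Om (S n)) (noise (S n) i t) 0 Sigma_w"
  obtains K where "K \<ge> 0"
    "\<And>n p q. n \<ge> 1 \<Longrightarrow>
       J d n mu (S n) (signal_law d p) \<le> J d n mu (S n) (signal_law d q) + ennreal (K / real n)"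
proof -
  let ?nu = "\<lambda>n \<omega>. mean_noise n mu (\<lambda>i k. follower_inputs n (hor d) (S n) \<omega> (i, k))"
  let ?mean = "\<lambda>p l n \<omega>. mean_cost d (nominal d mu l) (fluct d p (?nu n \<omega>))"
  let ?c = "\<lambda>l. mean_cost d (nominal d mu l) (\<lambda>k. (0, 0, 0))"
  have "mean_O1 (\<lambda>n. Om (S n)) (?mean p) ?c" for p
    by (intro mean_O1_mean_cost prob centered_O1_mean_noise[OF prob indep init noise]) auto
  then have "\<exists>K\<ge>0. \<forall>n\<ge>1. \<forall>l. integrable (Om (S n)) (?mean p l n) \<and>
     \<bar>integral\<^sup>L (Om (S n)) (?mean p l n) - ?c l\<bar> \<le> K / real n" for p
    by (simp add: mean_O1_def)
  then obtain K where K: "K p \<ge> 0"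
    and int: "n \<ge> 1 \<Longrightarrow> integrable (Om (S n)) (?mean p l n)"
    and le: "n \<ge> 1 \<Longrightarrow> \<bar>integral\<^sup>L (Om (S n)) (?mean p l n) - ?c l\<bar> \<le> K p / real n" for p n l
    by metis
  show ?thesis
  proof
    \<comment> \<open>Each law is within \<open>K p / n\<close> of the nominal cost, so two laws
      differ by at most the sum, which is symmetric in \<open>p\<close> and \<open>q\<close> and
      thus serves both directions.\<close>
    show "K True + K False \<ge> 0" using K by (simp add: add_nonneg_nonneg)
    fix n p q assume n: "n \<ge> (1::nat)"
    interpret prob_space "Om (S n)" using prob[OF n] .
    let ?X = "leader_inputs (hor d) (S n)" and ?Y = "follower_inputs n (hor d) (S n)"
    let ?D = "\<lambda>\<omega>'. dev_cost d n (\<lambda>i k. ?Y \<omega>' (i, k))"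
    have dev: "?D \<in> borel_measurable (Om (S n))"
    proof (rule borel_measurable_dev_cost)
      fix i k assume "i \<in> {1..n}" "k < hor d"
      then have "inputs (S n) (i, k) \<in> borel_measurable (Om (S n))"
        using indep[OF n] unfolding mutually_independent_iff indep_vars_def by auto
      with \<open>i \<in> {1..n}\<close> \<open>k < hor d\<close> show "(\<lambda>\<omega>'. ?Y \<omega>' (i, k)) \<in> borel_measurable (Om (S n))"
        by simp
    qed
    have split: "(\<integral>\<^sup>+\<omega>'. ennreal (split_cost d n mu p x (?Y \<omega>')) \<partial>Om (S n)) =
      ennreal (integral\<^sup>L (Om (S n)) (?mean p (\<lambda>k. x (0, k)) n)) + (\<integral>\<^sup>+\<omega>'. ennreal (?D \<omega>') \<partial>Om (S n))" for p x
    proof -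
      have nonneg: "?mean p (\<lambda>k. x (0, k)) n \<omega>' \<ge> 0" "?D \<omega>' \<ge> 0" for \<omega>'
        using definite by (auto intro!: mean_cost_nonneg dev_cost_nonneg)
      have "(\<integral>\<^sup>+\<omega>'. ennreal (split_cost d n mu p x (?Y \<omega>')) \<partial>Om (S n)) =
        (\<integral>\<^sup>+\<omega>'. ennreal (?mean p (\<lambda>k. x (0, k)) n \<omega>') + ennreal (?D \<omega>') \<partial>Om (S n))"
        unfolding split_cost_def using nonneg by (simp add: ennreal_plus)
      also have "\<dots> = (\<integral>\<^sup>+\<omega>'. ennreal (?mean p (\<lambda>k. x (0, k)) n \<omega>') \<partial>Om (S n))
          + (\<integral>\<^sup>+\<omega>'. ennreal (?D \<omega>') \<partial>Om (S n))"
        using borel_measurable_integrable[OF int[OF n]] dev by (intro nn_integral_add) auto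
      also have "(\<integral>\<^sup>+\<omega>'. ennreal (?mean p (\<lambda>k. x (0, k)) n \<omega>') \<partial>Om (S n)) =
          ennreal (integral\<^sup>L (Om (S n)) (?mean p (\<lambda>k. x (0, k)) n))"
        using nonneg int[OF n] by (intro nn_integral_eq_integral) auto
      finally show ?thesis .
    qed
    have pq: "integral\<^sup>L (Om (S n)) (?mean p l n) \<le>
      integral\<^sup>L (Om (S n)) (?mean q l n) + (K True + K False) / real n" for l
    proof (cases "p = q")
      case True
      then show ?thesis using K by (simp add: add_nonneg_nonneg)
    next
      case False
      then have "K True + K False = K p + K q" by (cases p; cases q) auto
      then show ?thesis
        using le[OF n, where p = p and l = l] le[OF n, where p = q and l = l] by (simp add: add_divide_distrib abs_le_iff)
    qed
    have inner: "(\<integral>\<^sup>+\<omega>'. ennreal (split_cost d n mu p x (?Y \<omega>')) \<partial>Om (S n)) \<le>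
      (\<integral>\<^sup>+\<omega>'. ennreal (split_cost d n mu q x (?Y \<omega>')) \<partial>Om (S n)) + ennreal ((K True + K False) / real n)" for x
    proof -
      have nonneg: "integral\<^sup>L (Om (S n)) (?mean q (\<lambda>k. x (0, k)) n) \<ge> 0"
        using definite by (intro Bochner_Integration.integral_nonneg mean_cost_nonneg) auto
      have "ennreal (integral\<^sup>L (Om (S n)) (?mean p (\<lambda>k. x (0, k)) n)) \<le>
        ennreal (integral\<^sup>L (Om (S n)) (?mean q (\<lambda>k. x (0, k)) n) + (K True + K False) / real n)"
        by (rule ennreal_leI[OF pq])
      also have "\<dots> = ennreal (integral\<^sup>L (Om (S n)) (?mean q (\<lambda>k. x (0, k)) n))
          + ennreal ((K True + K False) / real n)"
        by (rule ennreal_plus[OF nonneg]) (use K in \<open>simp add: add_nonneg_nonneg\<close>)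
      finally have "ennreal (integral\<^sup>L (Om (S n)) (?mean p (\<lambda>k. x (0, k)) n)) \<le>
        ennreal (integral\<^sup>L (Om (S n)) (?mean q (\<lambda>k. x (0, k)) n))
          + ennreal ((K True + K False) / real n)" .
      from add_right_mono[OF this, of "\<integral>\<^sup>+\<omega>'. ennreal (?D \<omega>') \<partial>Om (S n)"]
      show ?thesis
        unfolding split by (simp only: ac_simps)
    qed
    have "J d n mu (S n) (signal_law d p) =
      (\<integral>\<^sup>+\<omega>. \<integral>\<^sup>+\<omega>'. ennreal (split_cost d n mu p (?X \<omega>) (?Y \<omega>')) \<partial>Om (S n) \<partial>Om (S n))"
      by (rule J_signal_law(1)[OF n prob[OF n] indep[OF n]])
    also have "\<dots> \<le> (\<integral>\<^sup>+\<omega>. (\<integral>\<^sup>+\<omega>'. ennreal (split_cost d n mu q (?X \<omega>) (?Y \<omega>')) \<partial>Om (S n))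
        + ennreal ((K True + K False) / real n) \<partial>Om (S n))"
      by (intro nn_integral_mono inner)
    also have "\<dots> = J d n mu (S n) (signal_law d q) + ennreal ((K True + K False) / real n)"
      using J_signal_law(2)[OF n prob[OF n] indep[OF n]]
      by (subst nn_integral_add)
         (simp_all add: J_signal_law(1)[OF n prob[OF n] indep[OF n]] emeasure_space_1 del: One_nat_def)
    finally show "J d n mu (S n) (signal_law d p) \<le>
        J d n mu (S n) (signal_law d q) + ennreal ((K True + K False) / real n)" .
  qed
qed

text \<open>A law may ignore the mean-field; therefore \<open>J_star\<close> bounds the cost of
  every strategy from below, and closeness to \<open>J_star\<close> becomes near-optimality.\<close>

lemma strategies_subset_mf_strategies:
  "(strategies :: ('x::finite, 'u::finite) laws set) \<subseteq> mf_strategies"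
proof
  fix s :: "('x, 'u) laws" assume "s \<in> strategies"
  then obtain g0 :: "nat \<Rightarrow> real^'x \<Rightarrow> real^'u" and g :: "nat \<Rightarrow> nat \<Rightarrow> real^'x \<Rightarrow> real^'x \<Rightarrow> real^'u"
    where s: "s = (\<lambda>t x0 xb z. g0 t x0, \<lambda>i t xi x0 xb z. g i t xi x0)"
      and g0: "\<And>t. g0 t \<in> borel_measurable borel"
      and g: "\<And>i t. (\<lambda>(xi, x0). g i t xi x0) \<in> borel_measurable borel"
    unfolding strategies_def by blast
  have "(\<lambda>(x0, xb). g0 t x0) \<in> borel_measurable (borel :: ((real^'x) \<times> (real^'x)) measure)" for t
    unfolding case_prod_beta
    by (intro measurable_compose[OF _ g0] borel_measurable_continuous_onI continuous_intros)
  moreover have "(\<lambda>(xi, x0, xb). g i t xi x0) \<in> borel_measurable (borel :: ((real^'x) \<times> (real^'x) \<times> (real^'x)) measure)"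
    for i t
  proof -
    have "(\<lambda>v :: (real^'x) \<times> (real^'x) \<times> (real^'x). (fst v, fst (snd v))) \<in> borel_measurable borel"
      by (intro borel_measurable_continuous_onI continuous_intros)
    from measurable_compose[OF this g[of i t]] show ?thesis
      by (simp add: case_prod_beta)
  qed
  ultimately show "s \<in> mf_strategies"
    unfolding mf_strategies_def s by (auto intro!: exI[of _ "\<lambda>t x0 xb. g0 t x0"] exI[of _ "\<lambda>i t xi x0 xb. g i t xi x0"])
qed

theorem theorem2:
  fixes d :: "('x::finite, 'u::finite) lq_data"
    and mu_x :: "real^'x"
    and Sigma_x Sigma_w :: "real^'x^'x"
    and S :: "nat \<Rightarrow> ('w, 'x) randomness"
  assumes symmetric: "\<forall>t\<in>{1..hor d}.
        sym_matrix (mQ0 d t) \<and> sym_matrix (mF d t) \<and> sym_matrix (mR0 d t) \<and> sym_matrix (mQ d t) \<and>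
        sym_matrix (mP d t) \<and> sym_matrix (mR d t) \<and> sym_matrix (mH d t)"
    and definite: "\<forall>t\<in>{1..hor d}.
        pos_semidef (mQ d t + mP d t + mH d t) \<and> pos_semidef (Qbar d t) \<and>
        pos_def (mR d t) \<and> pos_def (mR0 d t)"
    and prob: "\<forall>n\<ge>1. prob_space (Om (S n))"
    and indep: "\<forall>n\<ge>1. mutually_independent n (hor d) (S n)"
    and init_iid: "\<forall>n\<ge>1. identically_distributed (Om (S n)) (init (S n)) {1..n} \<and>
        (\<forall>i\<in>{1..n}. has_mean_cov (Om (S n)) (init (S n) i) mu_x Sigma_x)"
    and noise_iid: "\<forall>n\<ge>1.
        identically_distributed (Om (S n)) (\<lambda>(i, t). noise (S n) i t) ({1..n} \<times> {1..hor d}) \<and>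
        (\<forall>i\<in>{1..n}. \<forall>t\<in>{1..hor d}. has_mean_cov (Om (S n)) (noise (S n) i t) 0 Sigma_w)"
    and attained: "\<forall>n\<ge>1. J d n mu_x (S n) (mf_linear d) = J_star d n mu_x (S n)"
  shows "\<exists>\<epsilon> :: nat \<Rightarrow> real.
      (\<forall>n. 0 \<le> \<epsilon> n) \<and> \<epsilon> \<longlonglongrightarrow> 0 \<and>
      (\<forall>n\<ge>1. \<forall>g\<in>strategies.
         J d n mu_x (S n) (proposed d) \<le> J d n mu_x (S n) g + ennreal (\<epsilon> n)) \<and>
      (\<forall>n\<ge>1.
         J d n mu_x (S n) (proposed d) \<le> J_star d n mu_x (S n) + ennreal (\<epsilon> n) \<and>
         J_star d n mu_x (S n) \<le> J d n mu_x (S n) (proposed d) + ennreal (\<epsilon> n)) \<and>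
      \<epsilon> \<in> O(\<lambda>n. 1 / real n)"
proof -
  obtain K where K: "K \<ge> 0" and le: "\<And>n p q. n \<ge> 1 \<Longrightarrow> J d n mu_x (S n) (signal_law d p)
      \<le> J d n mu_x (S n) (signal_law d q) + ennreal (K / real n)"
    using J_signal_law_le[OF definite, of S mu_x Sigma_x Sigma_w] prob indep init_iid noise_iid by blast
  \<comment> \<open>One estimate used in both directions; \<open>attained\<close> identifies the
    cost of mean-field feedback with \<open>J_star\<close>.\<close>
  have star: "J d n mu_x (S n) (proposed d) \<le> J_star d n mu_x (S n) + ennreal (K / real n)"
    "J_star d n mu_x (S n) \<le> J d n mu_x (S n) (proposed d) + ennreal (K / real n)" if "n \<ge> 1" for n
    using le[OF that, of True False] le[OF that, of False True] attained that
    by (simp_all flip: proposed_eq_signal_law mf_linear_eq_signal_law)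
  have inf: "J_star d n mu_x (S n) \<le> J d n mu_x (S n) g" if "g \<in> strategies" for g n
    unfolding J_star_def using that strategies_subset_mf_strategies by (intro INF_lower) auto
  show ?thesis
  \<comment> \<open>At \<open>n = 0\<close> division by zero gives \<open>0\<close>, so the sign
    condition holds for all \<open>n\<close>.\<close>
  proof (intro exI[of _ "\<lambda>n. K / real n"] conjI allI impI ballI)
    show "0 \<le> K / real n" for n using K by simp
    show "(\<lambda>n. K / real n) \<longlonglongrightarrow> 0" by (rule lim_const_over_n)
    show "J d n mu_x (S n) (proposed d) \<le> J d n mu_x (S n) g + ennreal (K / real n)"
      if "1 \<le> n" "g \<in> strategies" for n g
      using star(1)[OF that(1)] inf[OF that(2)] by (meson add_right_mono order_trans)
    show "(\<lambda>n. K / real n) \<in> O(\<lambda>n. 1 / real n)"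
      by (intro bigoI[of _ K]) (simp add: K)
  qed (use star in auto)
qed

end
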